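(* Let $S$ be a round two-sphere in $\mathbb{HP}^1\cong S^4$ with a chosen conformal structure, let $S$ also denote its twistor lift (a projective line in $\mathbb{CP}^3$) and $Sj$ the twistor lift with the opposite conformal structure, and let $Q^2_S=\mathbb{P}(\{[S],[Sj]\}^{\perp})\cap Q^4$. Let $\pi_S:Q^2_S\to S\cong\mathbb{CP}^1$ send a line of $\mathbb{CP}^3$ meeting both $S$ and $Sj$ to its intersection point with $S$. (a) If $\varphi:\mathbb{Z}^2\to Q^2_S$ is a discrete conic net, then $\pi_S\circ\varphi:\mathbb{Z}^2\to S\cong\mathbb{CP}^1$ is a complex cross-ratio net: for every elementary face, the cross-ratio $[\pi_S\varphi(m+1,n),\pi_S\varphi(m,n),\pi_S\varphi(m,n+1),\pi_S\varphi(m+1,n+1)]\in\mathbb{C}$ equals the Steiner cross-ratio of $\varphi(m+1,n),\varphi(m,n),\varphi(m,n+1),\varphi(m+1,n+1)$ on the conic in which the plane of that face meets $Q^4$. (b) Let $p:\mathbb{Z}\to S$ be a discrete curve of points of the sphere $S$ (viewed as real points of $Q^2_S$), let $\lambda\in\mathbb{C}$, and let $\psi:\mathbb{Z}^2\to S\cong\mathbb{CP}^1$ be a complex cross-ratio evolution of $p$ by $\lambda$, i.e. $\psi(k,0)=p(k)$ and $[\psi(k+1,n),\psi(k,n),\psi(k,n+1),\psi(k+1,n+1)]=\lambda$ for all $k,n$. Then there is a unique discrete conjugate net $\varphi:\mathbb{Z}^2\to Q^2_S$ extending $p$ (with $\varphi(k,0)$ the real point over $p(k)$ and $\varphi(0,n)$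 the real point over $\psi(0,n)$) all of whose faces have Steiner cross-ratio $\lambda$, and it satisfies $\pi_S\circ\varphi=\psi$ (assuming the face conics encountered are irreducible).
   Context: $\mathbb{H}$ denotes the quaternions ($i^2=j^2=k^2=-1$, $jk=i$), $\mathbb{C}=\mathrm{span}_{\mathbb{R}}\{1,i\}$, $\mathbb{H}=\mathbb{C}\oplus j\mathbb{C}$. $\mathbb{H}^2$ is a right $\mathbb{H}$-vector space, identified with $\mathbb{C}^4$ by restricting scalars; right multiplication by $j$ is $\mathbb{C}$-antilinear ($vzj=vj\bar z$). $\mathbb{HP}^1=\{v\mathbb{H}\}\cong S^4$, $\mathbb{CP}^3=\mathbb{P}(\mathbb{C}^4)$. The twistor projection is $\tau:\mathbb{CP}^3\to\mathbb{HP}^1$, $v\mathbb{C}\mapsto v\mathbb{H}$; the twistor fibre over $v\mathbb{H}$ is the projective line through $[v],[vj]$. The Plücker quadric $Q^4=\{[\alpha]\in\mathbb{P}(\Lambda^2\mathbb{C}^4):\alpha\wedge\alpha=0\}$; $[v\wedge w]$ is identified with the projective line through $[v],[w]$. The symmetric bilinear form $(\alpha,\beta)\mapsto\alpha\wedge\beta\in\Lambda^4\mathbb{C}^4\cong\mathbb{C}$ defines $\perp$. The antilinear extension of $v\wedge w\mapsto vj\wedge wj$ induces a real structure $j$ on $Q^4$ whose fixed ("real") points are the twistor fibres $[v\wedge vj]$, identified with points $v\mathbb{H}$ of $S^4$. A round two-sphere is the image under a Möbius transformation (induced by $GL(2,\mathbb{H})$) of a real 2-plane in an affine chart of $\mathbb{HP}^1$;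 with a conformal structure it equals $\{l:Sl=l\}$ for some $S\in\mathrm{End}_{\mathbb{H}}(\mathbb{H}^2)$, $S^2=-1$, and its twistor lift is $\mathbb{P}\{v:Sv=vi\}$; the lift for the opposite conformal structure is its image under $j$. $Q^2_S$ is the set of lines of $\mathbb{CP}^3$ meeting both $S$ and $Sj$; its real points are the twistor fibres over points of the sphere $S$. Cross-ratio on $\mathbb{CP}^1$: $[z_1,z_2,z_3,z_4]=\frac{(z_1-z_2)(z_3-z_4)}{(z_2-z_3)(z_4-z_1)}$ (so $[\infty,1,0,\lambda]=\lambda$). Steiner cross-ratio of four points on an irreducible plane conic: the cross-ratio of their images under projection from a fixed point of the conic onto a line in the plane of the conic. A discrete conjugate net is a map $\varphi:\mathbb{Z}^2\to\mathbb{CP}^n$ such that the images of the four vertices of each elementary face lie in a projective plane; a discrete conic net in a quadric is a discrete conjugate net into the quadric such that each face plane meets the quadric in an irreducible conic. *)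

theory Defs
  imports "HOL-Analysis.Analysis"
begin

text \<open>C^4 = H^2 restricted to complex scalars.  A quaternion vector
(q1,q2) with q_a = z_a + j w_a (z_a, w_a complex) has complex coordinates
(z1,w1,z2,w2) = (v$1,v$2,v$3,v$4).  Right multiplication by a complex
number is the complex scalar multiplication; right multiplication by j is
(z + j w) j = - conj w + j conj z, an antilinear map.\<close>

type_synonym c4 = "complex^4"
type_synonym bv = "complex^(4 \<times> 4)"   \<comment> \<open>bivectors, Lambda^2 C^4, as antisymmetric arrays\<close>

definition jmap :: "c4 \<Rightarrow> c4" where
  "jmap v = vector [- cnj (v$2), cnj (v$1), - cnj (v$4), cnj (v$3)]"

definition H_linear :: "complex^4^4 \<Rightarrow> bool" where
  "H_linear S \<longleftrightarrow> (\<forall>v. S *v jmap v = jmap (S *v v))"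

text \<open>Twistor lift of the sphere with complex structure S: P{v. Sv = vi}.\<close>
definition twistor_lift :: "complex^4^4 \<Rightarrow> c4 set" where
  "twistor_lift S = {v. S *v v = \<i> *s v}"

definition wedge :: "c4 \<Rightarrow> c4 \<Rightarrow> bv" where
  "wedge v w = (\<chi> ij. v $ fst ij * w $ snd ij - v $ snd ij * w $ fst ij)"

text \<open>The symmetric bilinear form alpha wedge beta in Lambda^4 C^4 = C
(volume form e1 e2 e3 e4).\<close>
definition wform :: "bv \<Rightarrow> bv \<Rightarrow> complex" where
  "wform a b =
     a$(1,2) * b$(3,4) - a$(1,3) * b$(2,4) + a$(1,4) * b$(2,3)
   + a$(2,3) * b$(1,4) - a$(2,4) * b$(1,3) + a$(3,4) * b$(1,2)"

definition antisym_bv :: "bv \<Rightarrow> bool" where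
  "antisym_bv a \<longleftrightarrow> (\<forall>i j. a$(i,j) = - a$(j,i))"

definition inQ4 :: "bv \<Rightarrow> bool" where
  "inQ4 a \<longleftrightarrow> a \<noteq> 0 \<and> antisym_bv a \<and> wform a a = 0"

definition ppar :: "'a::field^'n \<Rightarrow> 'a^'n \<Rightarrow> bool" where
  "ppar u v \<longleftrightarrow> u \<noteq> 0 \<and> v \<noteq> 0 \<and> (\<exists>c. u = c *s v)"

definition cbasis2 :: "('a::field^'n) set \<Rightarrow> 'a^'n \<Rightarrow> 'a^'n \<Rightarrow> bool" where
  "cbasis2 L a b \<longleftrightarrow> a \<noteq> b \<and> vec.independent {a, b} \<and> vec.span {a, b} = L"

definition plk :: "c4 set \<Rightarrow> bv" where
  "plk L = (let ab = (SOME ab. cbasis2 L (fst ab) (snd ab)) in wedge (fst ab) (snd ab))"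

definition Q2S :: "complex^4^4 \<Rightarrow> bv \<Rightarrow> bool" where
  "Q2S S a \<longleftrightarrow> inQ4 a \<and> wform a (plk (twistor_lift S)) = 0
                \<and> wform a (plk (jmap ` twistor_lift S)) = 0"

definition in_line :: "c4 \<Rightarrow> bv \<Rightarrow> bool" where
  "in_line v a \<longleftrightarrow> (\<exists>x y w1 w2. a = wedge w1 w2 \<and> v = x *s w1 + y *s w2)"

definition piS :: "complex^4^4 \<Rightarrow> bv \<Rightarrow> c4" where
  "piS S a = (SOME v. v \<noteq> 0 \<and> v \<in> twistor_lift S \<and> in_line v a)"

text \<open>Real point of Q^4 (twistor fibre [v wedge vj]) over the point of S^4
determined by v.\<close>
definition real_pt :: "c4 \<Rightarrow> bv" where
  "real_pt v = wedge v (jmap v)"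

definition coord2 :: "'a::field^'n \<Rightarrow> 'a^'n \<Rightarrow> 'a^'n \<Rightarrow> 'a \<times> 'a" where
  "coord2 a b v = (SOME xy. v = fst xy *s a + snd xy *s b)"

definition det2 :: "'a::field^'n \<Rightarrow> 'a^'n \<Rightarrow> 'a^'n \<Rightarrow> 'a^'n \<Rightarrow> 'a" where
  "det2 a b u v = fst (coord2 a b u) * snd (coord2 a b v) - fst (coord2 a b v) * snd (coord2 a b u)"

text \<open>Cross-ratio [z1,z2,z3,z4] = (z1-z2)(z3-z4)/((z2-z3)(z4-z1)) of four
points of the projective line P(L), computed in homogeneous coordinates with
respect to a basis of L (the value does not depend on the basis).\<close>
definition cr_on :: "('a::field^'n) set \<Rightarrow> 'a^'n \<Rightarrow> 'a^'n \<Rightarrow> 'a^'n \<Rightarrow> 'a^'n \<Rightarrow> 'a" where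
  "cr_on L v1 v2 v3 v4 =
     (let ab = (SOME ab. cbasis2 L (fst ab) (snd ab)); a = fst ab; b = snd ab in
       det2 a b v1 v2 * det2 a b v3 v4 / (det2 a b v2 v3 * det2 a b v4 v1))"

text \<open>P is (the linear span of) a projective plane of P(Lambda^2) meeting Q^4 in
an irreducible conic: the quadratic form restricted to P is nondegenerate.\<close>
definition irreducible_conic_plane :: "bv set \<Rightarrow> bool" where
  "irreducible_conic_plane P \<longleftrightarrow> vec.subspace P \<and> vec.dim P = 3 \<and>
     (\<forall>x\<in>P. (\<forall>y\<in>P. wform x y = 0) \<longrightarrow> x = 0)"

text \<open>Projection from the point c of the conic onto the line P(W) of the
plane: the image of x \<noteq> c is P(W) meet line(c,x); the image of c itself is
P(W) meet the tangent line at c.\<close>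
definition conic_proj :: "bv \<Rightarrow> bv set \<Rightarrow> bv \<Rightarrow> bv" where
  "conic_proj c W x = (SOME w. w \<in> W \<and> w \<noteq> 0 \<and>
      (if (\<exists>t. x = t *s c) then wform c w = 0 else w \<in> vec.span {c, x}))"

definition steiner_cr :: "bv set \<Rightarrow> bv \<Rightarrow> bv \<Rightarrow> bv \<Rightarrow> bv \<Rightarrow> complex" where
  "steiner_cr P x1 x2 x3 x4 =
     (let cW = (SOME cW. fst cW \<in> P \<and> fst cW \<noteq> 0 \<and> wform (fst cW) (fst cW) = 0 \<and>
                        vec.subspace (snd cW) \<and> snd cW \<subseteq> P \<and> vec.dim (snd cW) = 2 \<and>
                        fst cW \<notin> snd cW);
          c = fst cW; W = snd cW in
       cr_on W (conic_proj c W x1) (conic_proj c W x2) (conic_proj c W x3) (conic_proj c W x4))"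

definition face_plane :: "(int \<Rightarrow> int \<Rightarrow> bv) \<Rightarrow> int \<Rightarrow> int \<Rightarrow> bv set" where
  "face_plane \<phi> m n = vec.span {\<phi> (m+1) n, \<phi> m n, \<phi> m (n+1), \<phi> (m+1) (n+1)}"

definition conjugate_net :: "(int \<Rightarrow> int \<Rightarrow> 'a::field^'n) \<Rightarrow> bool" where
  "conjugate_net \<phi> \<longleftrightarrow> (\<forall>m n. \<phi> m n \<noteq> 0) \<and>
     (\<forall>m n. vec.dim (vec.span {\<phi> (m+1) n, \<phi> m n, \<phi> m (n+1), \<phi> (m+1) (n+1)}) \<le> 3)"

definition conic_net_Q4 :: "(int \<Rightarrow> int \<Rightarrow> bv) \<Rightarrow> bool" where
  "conic_net_Q4 \<phi> \<longleftrightarrow> conjugate_net \<phi> \<and> (\<forall>m n. inQ4 (\<phi> m n)) \<and>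
     (\<forall>m n. irreducible_conic_plane (face_plane \<phi> m n))"

definition face_steiner :: "(int \<Rightarrow> int \<Rightarrow> bv) \<Rightarrow> int \<Rightarrow> int \<Rightarrow> complex" where
  "face_steiner \<phi> m n = steiner_cr (face_plane \<phi> m n)
      (\<phi> (m+1) n) (\<phi> m n) (\<phi> m (n+1)) (\<phi> (m+1) (n+1))"

definition face_cr :: "c4 set \<Rightarrow> (int \<Rightarrow> int \<Rightarrow> c4) \<Rightarrow> int \<Rightarrow> int \<Rightarrow> complex" where
  "face_cr L \<psi> m n = cr_on L (\<psi> (m+1) n) (\<psi> m n) (\<psi> m (n+1)) (\<psi> (m+1) (n+1))"

text \<open>Recursive construction from the two axes: in the face (m,n) the vertex
farthest from the axes is the one determined by the other three.\<close>
definition far_corner :: "int \<Rightarrow> int \<Rightarrow> int \<times> int" where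
  "far_corner m n = (if m \<ge> 0 then m+1 else m, if n \<ge> 0 then n+1 else n)"

definition known_plane :: "(int \<Rightarrow> int \<Rightarrow> bv) \<Rightarrow> int \<Rightarrow> int \<Rightarrow> bv set" where
  "known_plane \<phi> m n = vec.span ((\<lambda>(k,l). \<phi> k l) `
       ({(m+1,n), (m,n), (m,n+1), (m+1,n+1)} - {far_corner m n}))"

definition boundary_ok :: "(int \<Rightarrow> c4) \<Rightarrow> (int \<Rightarrow> int \<Rightarrow> c4) \<Rightarrow> (int \<Rightarrow> int \<Rightarrow> bv) \<Rightarrow> bool" where
  "boundary_ok p \<psi> \<phi> \<longleftrightarrow> (\<forall>k. ppar (\<phi> k 0) (real_pt (p k))) \<and>
                           (\<forall>n. ppar (\<phi> 0 n) (real_pt (\<psi> 0 n)))"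

text \<open>Hypothesis that the face conics encountered in the construction are
irreducible: however the net is continued after a reducible conic, no face
whose three known vertices come from the construction is reducible.\<close>
definition construction_irreducible ::
  "complex^4^4 \<Rightarrow> (int \<Rightarrow> c4) \<Rightarrow> (int \<Rightarrow> int \<Rightarrow> c4) \<Rightarrow> complex \<Rightarrow> bool" where
  "construction_irreducible S p \<psi> lam \<longleftrightarrow>
     (\<forall>\<phi>. (\<forall>k l. Q2S S (\<phi> k l)) \<and> boundary_ok p \<psi> \<phi> \<and>
          (\<forall>m n. irreducible_conic_plane (known_plane \<phi> m n) \<longrightarrow>
                 (case far_corner m n of (k,l) \<Rightarrow> \<phi> k l \<in> known_plane \<phi> m n) \<and>
                 steiner_cr (known_plane \<phi> m n)
                    (\<phi> (m+1) n) (\<phi> m n) (\<phi> m (n+1)) (\<phi> (m+1) (n+1)) = lam)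
      \<longrightarrow> (\<forall>m n. irreducible_conic_plane (known_plane \<phi> m n)))"

end

theory Submission
  imports Defs
begin

text \<open>Since S squares to -1 and commutes with j, the space C^4 is the direct sum of the
planes L and jL lying over the two twistor lifts.  A line meeting both lifts is u \<and> w with u in L
and w in jL, so Q^2_S is the Segre quadric P(L) \<times> P(jL) and the projection to S forgets w.  A plane
meeting it in an irreducible conic is spanned by the points u \<and> g u of the graph of a projective
isomorphism g from P(L) to P(jL).  Projecting the conic from one of its points is linear in u, hence
the Steiner cross-ratio of points of the conic is the cross-ratio of their images in P(L).

Consequently the fourth vertex of a face is determined by the other three and the value \<lambda>, both
on the conic and on P(L), and the net is built outwards from the two axes.  The value \<lambda> = 0 is
excluded by the irreducibility hypothesis: there the new vertex coincides with a neighbour, and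
the next face is degenerate.\<close>

section \<open>Cross-ratios on a projective line\<close>

text \<open>Every choice in the definitions (a basis of a line, the centre and target line of the
  Steiner projection, the projected points, the point of S on a line) is made by
  \<open>SOME\<close>, so each must be shown satisfiable and then shown not to affect the result.
  Homogeneous coordinates serve both ends: points of a line are pairs of scalars, the invariant is
  the 2x2 determinant \<open>cross2\<close>, infinity needs no case, and a change of choice
  multiplies determinants by factors that cancel in the cross-ratio. Conic and line are linked by
  the Veronese map (s, t) -> (s^2, t^2, s t). Projecting from its point at (1, 0) drops the first
  coordinate and leaves t times (t, s), which is linear after division; SL(2) carries any other
  centre there without changing determinants. In (b), irreducibility is assumed about nets already
  defined on all of Z^2. The construction step is therefore total, with an arbitrary point of Q^2_S
  after a reducible plane, and the hypothesis is applied to the finished net.\<close>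

definition cross2 :: "'a::field \<times> 'a \<Rightarrow> 'a \<times> 'a \<Rightarrow> 'a" where
  "cross2 p q = fst p * snd q - fst q * snd p"

text \<open>With z = fst / snd, \<open>cross2 p q\<close> is the difference of the two z-values
  times \<open>snd p * snd q\<close>. All second coordinates cancel, so this extends the affine
  cross-ratio to infinity.\<close>

definition cross_ratio2 :: "'a::field \<times> 'a \<Rightarrow> 'a \<times> 'a \<Rightarrow> 'a \<times> 'a \<Rightarrow> 'a \<times> 'a \<Rightarrow> 'a" where
  "cross_ratio2 p q r s = cross2 p q * cross2 r s / (cross2 q r * cross2 s p)"

definition comb :: "'a::field^'n \<Rightarrow> 'a^'n \<Rightarrow> 'a \<times> 'a \<Rightarrow> 'a^'n" where
  "comb a b p = fst p *s a + snd p *s b"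

lemma comb_zero [simp]: "comb a b (0, 0) = 0"
  by (simp add: comb_def)

lemma comb_diff: "comb a b p - comb a b q = comb a b (fst p - fst q, snd p - snd q)"
  by (simp add: comb_def vec_eq_iff algebra_simps)

lemma comb_scale: "x *s comb a b p = comb a b (x * fst p, x * snd p)"
  by (simp add: comb_def vec_eq_iff algebra_simps)

lemma span_pair_eq_range: "vec.span {a, b} = range (comb a b)"
proof (intro set_eqI)
  fix x
  have "x \<in> vec.span {a, b} \<longleftrightarrow> (\<exists>k l. x - k *s a = l *s b)"
    by (simp add: vec.span_breakdown_eq)
  also have "\<dots> \<longleftrightarrow> x \<in> range (comb a b)"
    by (auto simp: comb_def algebra_simps image_iff)
  finally show "x \<in> vec.span {a, b} \<longleftrightarrow> x \<in> range (comb a b)" .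
qed

lemma cbasis2_eq_range: "cbasis2 L a b \<Longrightarrow> L = range (comb a b)"
  by (simp add: cbasis2_def span_pair_eq_range[symmetric])

lemma comb_eq_0_iff:
  assumes "cbasis2 L a b"
  shows "comb a b p = 0 \<longleftrightarrow> p = (0, 0)"
proof
  assume 0: "comb a b p = 0"
  have ind: "vec.independent {a, b}" "a \<noteq> b" using assms by (auto simp: cbasis2_def)
  have b0: "b \<noteq> 0" using ind vec.dependent_zero[of "{a,b}"] by auto
  have na: "a \<notin> vec.span {b}"
    using ind by (simp add: vec.independent_insert)
  have "fst p = 0"
  proof (rule ccontr)
    assume f: "fst p \<noteq> 0"
    have "fst p *s a = (- snd p) *s b"
      using 0 by (simp add: comb_def eq_neg_iff_add_eq_0)
    then have "fst p *s a \<in> vec.span {b}"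
      by (metis singletonI vec.span_base vec.span_scale)
    then have "inverse (fst p) *s (fst p *s a) \<in> vec.span {b}" by (rule vec.span_scale)
    with f na show False by simp
  qed
  with 0 b0 show "p = (0,0)" by (cases p) (auto simp: comb_def)
qed simp

lemma comb_eq_iff:
  assumes "cbasis2 L a b"
  shows "comb a b p = comb a b q \<longleftrightarrow> p = q"
proof
  assume "comb a b p = comb a b q"
  then have "comb a b (fst p - fst q, snd p - snd q) = 0"
    by (metis comb_diff right_minus_eq)
  then show "p = q" using comb_eq_0_iff[OF assms] by (simp add: prod_eq_iff)
qed simp

lemma cbasis2I:
  assumes "L = range (comb a b)" "\<And>p. comb a b p = 0 \<Longrightarrow> p = (0,0)"
  shows "cbasis2 L a b"
proof -
  have ne: "a \<noteq> b" using assms(2)[of "(1,-1)"] by (auto simp: comb_def)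
  have b0: "b \<noteq> 0" using assms(2)[of "(0,1)"] by (auto simp: comb_def)
  have "a \<notin> vec.span {b}"
  proof
    assume "a \<in> vec.span {b}"
    then obtain k where "a = k *s b" using vec.span_singleton[of b] by auto
    then show False using assms(2)[of "(1,-k)"] by (auto simp: comb_def)
  qed
  then have ind: "vec.independent {a, b}" using b0 ne by (simp add: vec.independent_insert)
  show ?thesis using ne ind assms(1) span_pair_eq_range[of a b] by (simp add: cbasis2_def)
qed

lemma cbasis2_exists:
  assumes "vec.subspace L" "vec.dim L = 2"
  shows "\<exists>a b. cbasis2 L a b"
proof -
  obtain B where B: "B \<subseteq> L" "vec.independent B" "L \<subseteq> vec.span B" "card B = vec.dim L"
    using vec.basis_exists by blast
  then obtain a b where "B = {a, b}" "a \<noteq> b" using assms(2) by (metis card_2_iff)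
  moreover have "vec.span B = L" using B assms(1) by (metis subset_antisym vec.span_minimal)
  ultimately show ?thesis using B by (auto simp: cbasis2_def)
qed

lemma coord2_comb:
  assumes "cbasis2 L a b"
  shows "coord2 a b (comb a b p) = p"
  unfolding coord2_def
proof (rule some_equality)
  show "comb a b p = fst p *s a + snd p *s b" by (simp add: comb_def)
  fix q assume "comb a b p = fst q *s a + snd q *s b"
  then show "q = p" using comb_eq_iff[OF assms] by (metis comb_def)
qed

text \<open>The basis hidden in \<open>cr_on\<close> is replaced by any given one: every
  \<open>det2\<close> acquires the transition determinant \<open>\<Delta>\<close>, twice above and
  twice below.\<close>

lemma cr_on_comb:
  assumes ab: "cbasis2 L a b"
  shows "cr_on L (comb a b p) (comb a b q) (comb a b r) (comb a b s) = cross_ratio2 p q r s"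
proof -
  define ab' where "ab' = (SOME ab. cbasis2 L (fst ab) (snd ab))"
  obtain c d where cd: "ab' = (c, d)" by (cases ab')
  have "cbasis2 L (fst ab') (snd ab')" unfolding ab'_def
    by (rule someI[of _ "(a, b)"]) (simp add: ab)
  then have L': "cbasis2 L c d" using cd by simp
  have "comb a b (1, 0) \<in> L" "comb a b (0, 1) \<in> L" using cbasis2_eq_range[OF ab] by auto
  then obtain m n where m: "a = comb c d m" and n: "b = comb c d n"
    using cbasis2_eq_range[OF L'] by (auto simp: comb_def)
  define \<Delta> where "\<Delta> = cross2 m n"
  have ch: "comb a b t = comb c d (fst t * fst m + snd t * fst n, fst t * snd m + snd t * snd n)" for t
    by (subst m, subst n) (simp add: comb_def vec_eq_iff algebra_simps)
  have "\<Delta> \<noteq> 0"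
  proof
    assume "\<Delta> = 0"
    \<comment> \<open>Up to sign these are the rows of the adjugate of the transition matrix; with
      determinant 0 they become linear relations between \<open>a\<close> and
      \<open>b\<close>.\<close>
    then have "comb a b (snd n, - snd m) = 0" "comb a b (fst n, - fst m) = 0"
      unfolding ch by (simp_all add: \<Delta>_def cross2_def comb_def algebra_simps)
    then have "m = (0,0)" using comb_eq_0_iff[OF ab] by (auto simp: prod_eq_iff)
    then have "comb a b (1,0) = 0" using m by (simp add: comb_def)
    then show False using comb_eq_0_iff[OF ab] by simp
  qed
  have det: "det2 c d (comb a b t) (comb a b t') = \<Delta> * cross2 t t'" for t t'
    unfolding det2_def ch coord2_comb[OF L']
    by (simp add: \<Delta>_def cross2_def algebra_simps)
  have "cr_on L (comb a b p) (comb a b q) (comb a b r) (comb a b s)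
     = (\<Delta> * cross2 p q) * (\<Delta> * cross2 r s) / ((\<Delta> * cross2 q r) * (\<Delta> * cross2 s p))"
    unfolding cr_on_def ab'_def[symmetric] by (simp add: cd det)
  then show ?thesis using \<open>\<Delta> \<noteq> 0\<close> by (simp add: cross_ratio2_def)
qed

lemma cross_ratio2_scale:
  assumes "k1 \<noteq> 0" "k2 \<noteq> 0" "k3 \<noteq> 0" "k4 \<noteq> 0"
  shows "cross_ratio2 (k1 * fst p, k1 * snd p) (k2 * fst q, k2 * snd q)
           (k3 * fst r, k3 * snd r) (k4 * fst s, k4 * snd s) = cross_ratio2 p q r s"
proof -
  have c: "cross2 (k * fst u, k * snd u) (l * fst v, l * snd v) = (k * l) * cross2 u v"
    for k l and u v :: "'a \<times> 'a"
    by (simp add: cross2_def algebra_simps)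
  have n: "k1 * k2 * k3 * k4 \<noteq> 0" using assms by simp
  have "cross_ratio2 (k1 * fst p, k1 * snd p) (k2 * fst q, k2 * snd q)
           (k3 * fst r, k3 * snd r) (k4 * fst s, k4 * snd s)
      = ((k1 * k2 * k3 * k4) * (cross2 p q * cross2 r s))
        / ((k1 * k2 * k3 * k4) * (cross2 q r * cross2 s p))"
    unfolding cross_ratio2_def c by (simp add: mult_ac)
  then show ?thesis
    unfolding cross_ratio2_def mult_divide_mult_cancel_left[OF n] .
qed

lemma cross_ratio2_klein:
  "cross_ratio2 p q r s = cross_ratio2 q p s r"
  "cross_ratio2 p q r s = cross_ratio2 r s p q"
  by (simp_all add: cross_ratio2_def cross2_def algebra_simps)

lemma cross2_zero_imp_prop:
  assumes "cross2 p q = 0" "q \<noteq> (0,0)"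
  shows "\<exists>k. p = (k * fst q, k * snd q)"
proof (cases "fst q = 0")
  case True
  then have "snd q \<noteq> 0" using assms(2) by (metis prod.collapse)
  then have "p = ((snd p / snd q) * fst q, (snd p / snd q) * snd q)"
    using assms True by (simp add: cross2_def prod_eq_iff)
  then show ?thesis by blast
next
  case False
  then have "p = ((fst p / fst q) * fst q, (fst p / fst q) * snd q)"
    using assms by (simp add: cross2_def prod_eq_iff field_simps)
  then show ?thesis by blast
qed

lemma cross_ratio2_exists:
  assumes "cross2 p q \<noteq> 0" "cross2 q r \<noteq> 0" "cross2 p r \<noteq> (0::'a::field)"
  shows "\<exists>s. s \<noteq> (0,0) \<and> cross_ratio2 p q r s = l"
proof -
  \<comment> \<open>Clearing denominators gives an equation linear in \<open>s\<close>. For s = x r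
    + y p it reads \<open>cross2 p q * y = l * cross2 q r * x\<close>, solved by x =
    \<open>cross2 p q\<close> and y = \<open>l * cross2 q r\<close>.\<close>
  define s where s: "s = (cross2 p q * fst r + l * cross2 q r * fst p,
                          cross2 p q * snd r + l * cross2 q r * snd p)"
  have 1: "cross2 r s = l * cross2 q r * cross2 r p"
    unfolding s by (simp add: cross2_def algebra_simps)
  have 2: "cross2 s p = cross2 p q * cross2 r p"
    unfolding s by (simp add: cross2_def algebra_simps)
  have rp: "cross2 r p \<noteq> 0" using assms(3) by (auto simp: cross2_def algebra_simps)
  have "s \<noteq> (0,0)" using 2 rp assms(1) by (auto simp: cross2_def)
  moreover have "cross_ratio2 p q r s = l"
    unfolding cross_ratio2_def 1 2 using assms rp by simp
  ultimately show ?thesis by blast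
qed

lemma cross_ratio2_unique:
  assumes d: "cross2 p q \<noteq> 0" "cross2 q r \<noteq> 0" "cross2 p r \<noteq> (0::'a::field)" and l: "l \<noteq> 0"
    and s: "cross_ratio2 p q r s = l" "cross_ratio2 p q r s' = l"
  shows "cross2 s s' = 0"
proof -
  \<comment> \<open>A zero denominator would make the quotient 0, so \<open>l \<noteq> 0\<close>
    permits clearing it.\<close>
  have e: "cross2 p q * cross2 r t = l * cross2 q r * cross2 t p" if "cross_ratio2 p q r t = l" for t
  proof -
    have "cross2 q r * cross2 t p \<noteq> 0" using that l unfolding cross_ratio2_def by (metis division_ring_divide_zero)
    then show ?thesis using that unfolding cross_ratio2_def by (simp add: field_simps)
  qed
  \<comment> \<open>The Pluecker relation for four vectors of a plane; after multiplication by
    \<open>cross2 p q\<close> its right side cancels by the two linear equations.\<close>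
  have i: "cross2 r p * cross2 s s' = cross2 r s * cross2 p s' - cross2 p s * cross2 r s'"
    by (simp add: cross2_def algebra_simps)
  have "cross2 p q * (cross2 r p * cross2 s s')
      = (cross2 p q * cross2 r s) * cross2 p s' - cross2 p s * (cross2 p q * cross2 r s')"
    unfolding i by (simp add: algebra_simps)
  also have "\<dots> = 0"
    unfolding e[OF s(1)] e[OF s(2)] by (simp add: cross2_def algebra_simps)
  finally have "cross2 p q * (cross2 r p * cross2 s s') = 0" .
  moreover have "cross2 r p \<noteq> 0" using d(3) by (auto simp: cross2_def algebra_simps)
  ultimately show ?thesis using d(1) by simp
qed

section \<open>Projective points and cross-ratios as functions of them\<close>

lemma ppar_sym: "ppar u v \<Longrightarrow> ppar v u"
proof -
  assume "ppar u v"
  then obtain c where c: "u = c *s v" "u \<noteq> 0" "v \<noteq> 0" by (auto simp: ppar_def)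
  then have "c \<noteq> 0" by auto
  then have "v = inverse c *s u" using c by simp
  then show ?thesis using c unfolding ppar_def by blast
qed

lemma ppar_trans: "ppar u v \<Longrightarrow> ppar v w \<Longrightarrow> ppar u w"
  unfolding ppar_def by (metis vector_smult_assoc)

lemma ppar_refl: "u \<noteq> 0 \<Longrightarrow> ppar u u"
  unfolding ppar_def by (metis vector_smult_lid)

lemma ppar_scale: "u \<noteq> 0 \<Longrightarrow> c \<noteq> 0 \<Longrightarrow> ppar (c *s u) u"
  unfolding ppar_def by auto

lemma ppar_comb_iff:
  assumes "cbasis2 L a b" "p \<noteq> (0,0)" "q \<noteq> (0,0)"
  shows "ppar (comb a b p) (comb a b q) \<longleftrightarrow> cross2 p q = 0"
proof
  assume "ppar (comb a b p) (comb a b q)"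
  then obtain c where "comb a b p = comb a b (c * fst q, c * snd q)"
    unfolding ppar_def comb_scale by blast
  then have "p = (c * fst q, c * snd q)" using comb_eq_iff[OF assms(1)] by blast
  then show "cross2 p q = 0" by (simp add: cross2_def)
next
  assume "cross2 p q = 0"
  then obtain k where "p = (k * fst q, k * snd q)" using cross2_zero_imp_prop assms by blast
  then have "comb a b p = k *s comb a b q" by (simp add: comb_scale)
  then show "ppar (comb a b p) (comb a b q)"
    using comb_eq_0_iff[OF assms(1)] assms(2,3) unfolding ppar_def by blast
qed

definition line_basis :: "('a::field^'n) set \<Rightarrow> bool" where
  "line_basis L \<longleftrightarrow> (\<exists>a b. cbasis2 L a b)"

text \<open>Each argument occurs once above and once below, so scalars cancel. Representatives
  chosen by \<open>SOME\<close>, such as values of \<open>piS\<close> and \<open>conic_proj\<close>,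
  can thus be exchanged for explicit ones.\<close>

lemma cr_on_ppar:
  assumes L: "line_basis L" and m: "v1 \<in> L" "v2 \<in> L" "v3 \<in> L" "v4 \<in> L"
    and p: "ppar u1 v1" "ppar u2 v2" "ppar u3 v3" "ppar u4 v4"
  shows "cr_on L u1 u2 u3 u4 = cr_on L v1 v2 v3 v4"
proof -
  obtain a b where ab: "cbasis2 L a b" using L by (auto simp: line_basis_def)
  obtain p1 p2 p3 p4 where v: "v1 = comb a b p1" "v2 = comb a b p2" "v3 = comb a b p3" "v4 = comb a b p4"
    using m cbasis2_eq_range[OF ab] by blast
  obtain k1 k2 k3 k4 where u: "u1 = k1 *s v1" "u2 = k2 *s v2" "u3 = k3 *s v3" "u4 = k4 *s v4"
    using p unfolding ppar_def by blast
  have k: "k1 \<noteq> 0" "k2 \<noteq> 0" "k3 \<noteq> 0" "k4 \<noteq> 0" using p u by (auto simp: ppar_def)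
  show ?thesis unfolding u v comb_scale cr_on_comb[OF ab] using cross_ratio2_scale[OF k] .
qed

lemma cr_on_klein:
  assumes L: "line_basis L" and m: "v1 \<in> L" "v2 \<in> L" "v3 \<in> L" "v4 \<in> L"
  shows "cr_on L v1 v2 v3 v4 = cr_on L v2 v1 v4 v3" "cr_on L v1 v2 v3 v4 = cr_on L v3 v4 v1 v2"
proof -
  obtain a b where ab: "cbasis2 L a b" using L by (auto simp: line_basis_def)
  obtain p1 p2 p3 p4 where v: "v1 = comb a b p1" "v2 = comb a b p2" "v3 = comb a b p3" "v4 = comb a b p4"
    using m cbasis2_eq_range[OF ab] by blast
  show "cr_on L v1 v2 v3 v4 = cr_on L v2 v1 v4 v3" "cr_on L v1 v2 v3 v4 = cr_on L v3 v4 v1 v2"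
    unfolding v cr_on_comb[OF ab] by (rule cross_ratio2_klein)+
qed

lemma cr_on_exists:
  assumes L: "line_basis L" and m: "v1 \<in> L" "v2 \<in> L" "v3 \<in> L" "v1 \<noteq> 0" "v2 \<noteq> 0" "v3 \<noteq> 0"
    and d: "\<not> ppar v1 v2" "\<not> ppar v2 v3" "\<not> ppar v1 v3"
  shows "\<exists>v4\<in>L. v4 \<noteq> 0 \<and> cr_on L v1 v2 v3 v4 = l"
proof -
  obtain a b where ab: "cbasis2 L a b" using L by (auto simp: line_basis_def)
  obtain p1 p2 p3 where v: "v1 = comb a b p1" "v2 = comb a b p2" "v3 = comb a b p3"
    using m cbasis2_eq_range[OF ab] by blast
  have n: "p1 \<noteq> (0,0)" "p2 \<noteq> (0,0)" "p3 \<noteq> (0,0)" using m v by auto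
  have "cross2 p1 p2 \<noteq> 0" "cross2 p2 p3 \<noteq> 0" "cross2 p1 p3 \<noteq> 0"
    using d n unfolding v by (auto simp: ppar_comb_iff[OF ab])
  then obtain s where "s \<noteq> (0,0)" "cross_ratio2 p1 p2 p3 s = l"
    using cross_ratio2_exists by blast
  then show ?thesis unfolding v
    using cr_on_comb[OF ab] cbasis2_eq_range[OF ab] comb_eq_0_iff[OF ab] by blast
qed

lemma cr_on_unique:
  assumes L: "line_basis L" and m: "v1 \<in> L" "v2 \<in> L" "v3 \<in> L" "v1 \<noteq> 0" "v2 \<noteq> 0" "v3 \<noteq> 0"
    and d: "\<not> ppar v1 v2" "\<not> ppar v2 v3" "\<not> ppar v1 v3"
    and l: "l \<noteq> 0" and v4: "v4 \<in> L" "v4 \<noteq> 0" "cr_on L v1 v2 v3 v4 = l"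
    and v4': "v4' \<in> L" "v4' \<noteq> 0" "cr_on L v1 v2 v3 v4' = l"
  shows "ppar v4 v4'"
proof -
  obtain a b where ab: "cbasis2 L a b" using L by (auto simp: line_basis_def)
  obtain p1 p2 p3 p4 p4' where v: "v1 = comb a b p1" "v2 = comb a b p2" "v3 = comb a b p3"
     "v4 = comb a b p4" "v4' = comb a b p4'"
    using m v4 v4' cbasis2_eq_range[OF ab] by blast
  have n: "p1 \<noteq> (0,0)" "p2 \<noteq> (0,0)" "p3 \<noteq> (0,0)" "p4 \<noteq> (0,0)" "p4' \<noteq> (0,0)"
    using m v v4 v4' by auto
  have "cross2 p1 p2 \<noteq> 0" "cross2 p2 p3 \<noteq> 0" "cross2 p1 p3 \<noteq> 0"
    using d n unfolding v by (auto simp: ppar_comb_iff[OF ab])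
  then have "cross2 p4 p4' = 0"
    using cross_ratio2_unique l v4(3) v4'(3) unfolding v cr_on_comb[OF ab] by blast
  then show ?thesis unfolding v using n by (simp add: ppar_comb_iff[OF ab])
qed

text \<open>For the value 0 a solution is not unique, since x/0 = 0: besides the honest
v4 = v3 also the pole v4 = v1 qualifies.\<close>

lemma cr_on_zero:
  assumes L: "line_basis L" and m: "v1 \<in> L" "v2 \<in> L" "v3 \<in> L" "v1 \<noteq> 0" "v2 \<noteq> 0" "v3 \<noteq> 0"
    and d: "\<not> ppar v1 v2" "\<not> ppar v2 v3"
    and v4: "v4 \<in> L" "v4 \<noteq> 0" "cr_on L v1 v2 v3 v4 = 0"
  shows "ppar v4 v3 \<or> ppar v4 v1"
proof -
  obtain a b where ab: "cbasis2 L a b" using L by (auto simp: line_basis_def)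
  obtain p1 p2 p3 p4 where v: "v1 = comb a b p1" "v2 = comb a b p2" "v3 = comb a b p3"
     "v4 = comb a b p4"
    using m v4 cbasis2_eq_range[OF ab] by blast
  have n: "p1 \<noteq> (0,0)" "p2 \<noteq> (0,0)" "p3 \<noteq> (0,0)" "p4 \<noteq> (0,0)"
    using m v v4 by auto
  have "cross2 p1 p2 \<noteq> 0" "cross2 p2 p3 \<noteq> 0"
    using d n unfolding v by (auto simp: ppar_comb_iff[OF ab])
  then have "cross2 p3 p4 = 0 \<or> cross2 p4 p1 = 0"
    using v4(3) unfolding v cr_on_comb[OF ab] cross_ratio2_def by simp
  moreover have "cross2 p4 p3 = - cross2 p3 p4" by (simp add: cross2_def algebra_simps)
  ultimately show ?thesis unfolding v using n by (auto simp: ppar_comb_iff[OF ab])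
qed

section \<open>Conics in the Pluecker quadric\<close>

lemma wform_bilinear:
  "wform (x + y) z = wform x z + wform y z"
  "wform x (y + z) = wform x y + wform x z"
  "wform (k *s x) z = k * wform x z"
  "wform x (k *s z) = k * wform x z"
  "wform (x - y) z = wform x z - wform y z"
  "wform x (y - z) = wform x y - wform x z"
  "wform 0 z = 0" "wform x 0 = 0"
  by (simp_all add: wform_def algebra_simps)

lemma wform_commute: "wform x y = wform y x"
  by (simp add: wform_def algebra_simps)

definition comb3 :: "'a::field^'n \<Rightarrow> 'a^'n \<Rightarrow> 'a^'n \<Rightarrow> 'a \<Rightarrow> 'a \<Rightarrow> 'a \<Rightarrow> 'a^'n" where
  "comb3 x y z A B C = A *s x + B *s y + C *s z"

lemma span_triple: "vec.span {x, y, z} = {comb3 x y z A B C | A B C. True}"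
proof (intro set_eqI)
  fix v
  have "v \<in> vec.span {x, y, z} \<longleftrightarrow> (\<exists>A B C. v - A *s x - B *s y = C *s z)"
    by (simp add: vec.span_breakdown_eq)
  also have "\<dots> \<longleftrightarrow> v \<in> {comb3 x y z A B C | A B C. True}"
    by (auto simp: comb3_def algebra_simps)
  finally show "v \<in> vec.span {x, y, z} \<longleftrightarrow> v \<in> {comb3 x y z A B C | A B C. True}" .
qed

lemma independent_triple_coeff:
  assumes ind: "vec.independent {x, y, z}" and ne: "x \<noteq> y" "x \<noteq> z"
    and 0: "comb3 x y z A B C = 0"
  shows "A = 0"
proof (rule ccontr)
  assume A: "A \<noteq> 0"
  have "x \<notin> vec.span {y, z}" using ind ne by (simp add: vec.independent_insert)
  moreover have "x \<in> vec.span {y, z}"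
  proof -
    have "A *s x = (- B) *s y + (- C) *s z"
      using 0 by (simp add: comb3_def vec_eq_iff algebra_simps eq_neg_iff_add_eq_0)
    moreover have "(- B) *s y + (- C) *s z \<in> vec.span {y, z}"
      by (intro vec.span_add vec.span_scale vec.span_base) auto
    ultimately have "inverse A *s (A *s x) \<in> vec.span {y, z}" by (metis vec.span_scale)
    then show ?thesis using A by simp
  qed
  ultimately show False by blast
qed

lemma independent_triple:
  assumes "vec.independent {x, y, z}" "x \<noteq> y" "x \<noteq> z" "y \<noteq> z" "comb3 x y z A B C = 0"
  shows "A = 0 \<and> B = 0 \<and> C = 0"
proof (intro conjI)
  show "A = 0" using independent_triple_coeff[OF assms(1,2,3,5)] .
  have "comb3 y x z B A C = 0" using assms(5) by (simp add: comb3_def algebra_simps)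
  then show "B = 0" using independent_triple_coeff[of y x z B A C] assms(1-4)
    by (simp add: insert_commute)
  have "comb3 z x y C A B = 0" using assms(5) by (simp add: comb3_def algebra_simps)
  then show "C = 0" using independent_triple_coeff[of z x y C A B] assms(1-4)
    by (simp add: insert_commute)
qed

text \<open>Frames in which the conic of the plane P is xy = z^2.\<close>

definition conic_frame :: "bv set \<Rightarrow> bv \<Rightarrow> bv \<Rightarrow> bv \<Rightarrow> bool" where
  "conic_frame P e1 e2 e3 \<longleftrightarrow> P = {comb3 e1 e2 e3 A B C | A B C. True} \<and> wform e1 e2 \<noteq> 0 \<and>
     wform e1 e1 = 0 \<and> wform e2 e2 = 0 \<and> wform e1 e3 = 0 \<and> wform e2 e3 = 0 \<and>
     wform e3 e3 = - 2 * wform e1 e2"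

text \<open>The Veronese parametrisation of xy = z^2 by the projective line; rescaling
  \<open>p\<close> by k rescales the point by k^2.\<close>

definition conic_pt :: "bv \<Rightarrow> bv \<Rightarrow> bv \<Rightarrow> complex \<times> complex \<Rightarrow> bv" where
  "conic_pt e1 e2 e3 p = comb3 e1 e2 e3 ((fst p)^2) ((snd p)^2) (fst p * snd p)"

lemma wform_comb3:
  assumes "conic_frame P e1 e2 e3"
  shows "wform (comb3 e1 e2 e3 A B C) (comb3 e1 e2 e3 A' B' C')
          = wform e1 e2 * (A * B' + B * A' - 2 * C * C')"
proof -
  have f: "wform e1 e1 = 0" "wform e2 e2 = 0" "wform e1 e3 = 0" "wform e2 e3 = 0"
    "wform e3 e1 = 0" "wform e3 e2 = 0" "wform e3 e3 = - 2 * wform e1 e2" "wform e2 e1 = wform e1 e2"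
    using assms by (auto simp: conic_frame_def wform_commute)
  show ?thesis unfolding comb3_def wform_bilinear f by (simp add: algebra_simps)
qed

text \<open>Independence of a frame comes from the form: pairing with \<open>e2\<close>,
  \<open>e1\<close> and \<open>e3\<close> recovers the three coordinates, because
  \<open>wform e1 e2\<close> is nonzero.\<close>

lemma comb3_eq_frame:
  assumes f: "conic_frame P e1 e2 e3"
    and e: "comb3 e1 e2 e3 A B C = comb3 e1 e2 e3 A' B' C'"
  shows "A = A' \<and> B = B' \<and> C = C'"
proof -
  have k: "wform e1 e2 \<noteq> 0" using f by (simp add: conic_frame_def)
  have "A * b + B * a - 2 * C * c = A' * b + B' * a - 2 * C' * c" for a b c
    using wform_comb3[OF f, of A B C a b c] wform_comb3[OF f, of A' B' C' a b c] e k by simp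
  from this[of 1 0 0] this[of 0 1 0] this[of 0 0 1] show ?thesis by simp
qed

lemma frame_null_vector:
  assumes f: "conic_frame P e1 e2 e3" and x: "x \<in> P" "x \<noteq> 0" "wform x x = 0"
  shows "\<exists>r p. r \<noteq> 0 \<and> p \<noteq> (0,0) \<and> x = r *s conic_pt e1 e2 e3 p"
proof -
  obtain A B C where xe: "x = comb3 e1 e2 e3 A B C" using f x by (auto simp: conic_frame_def)
  have AB: "A * B = C^2"
    using x(3) wform_comb3[OF f, of A B C A B C] f unfolding xe
    by (simp add: conic_frame_def algebra_simps power2_eq_square)
  show ?thesis
  proof (cases "A = 0")
    case True
    then have C: "C = 0" using AB by simp
    then have "B \<noteq> 0" using x(2) True xe by (auto simp: comb3_def)
    moreover have "x = B *s conic_pt e1 e2 e3 (0, 1)"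
      unfolding xe using True C by (simp add: conic_pt_def comb3_def)
    ultimately show ?thesis by (metis prod.inject zero_neq_one)
  next
    case False
    \<comment> \<open>As C^2 = A B, the parameter (A, C) gives (A^2, C^2, A C), which is A times the
      coordinates of \<open>x\<close>.\<close>
    have "x = (1/A) *s conic_pt e1 e2 e3 (A, C)"
      unfolding xe using False AB
      by (simp add: conic_pt_def comb3_def vec.scale_right_distrib power2_eq_square AB[unfolded power2_eq_square, symmetric])
    then show ?thesis using False by (metis divide_eq_0_iff prod.inject zero_neq_one)
  qed
qed

lemma conic_pt_null:
  assumes "conic_frame P e1 e2 e3"
  shows "wform (conic_pt e1 e2 e3 p) (conic_pt e1 e2 e3 p) = 0"
  unfolding conic_pt_def wform_comb3[OF assms] by (simp add: power2_eq_square)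

lemma conic_pt_in: "conic_frame P e1 e2 e3 \<Longrightarrow> r *s conic_pt e1 e2 e3 p \<in> P"
proof -
  assume "conic_frame P e1 e2 e3"
  moreover have "r *s conic_pt e1 e2 e3 p
    = comb3 e1 e2 e3 (r * (fst p)^2) (r * (snd p)^2) (r * (fst p * snd p))"
    by (simp add: conic_pt_def comb3_def vec.scale_right_distrib)
  ultimately show ?thesis by (auto simp: conic_frame_def)
qed

text \<open>The action of SL(2) on the parameter line induces changes of frame.\<close>

lemma frame_change:
  assumes f: "conic_frame P e1 e2 e3" and pq: "cross2 p q = 1"
  defines "h \<equiv> comb3 e1 e2 e3 (2 * fst p * fst q) (2 * snd p * snd q) (fst p * snd q + fst q * snd p)"
  shows "conic_frame P (conic_pt e1 e2 e3 p) (conic_pt e1 e2 e3 q) h"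
    and "conic_pt e1 e2 e3 r
          = conic_pt (conic_pt e1 e2 e3 p) (conic_pt e1 e2 e3 q) h (cross2 r q, cross2 p r)"
proof -
  \<comment> \<open>\<open>h\<close> is the polar term of the Veronese map: \<open>conic_pt\<close>
    at the sum of p and q is \<open>?p + ?q + h\<close>.\<close>
  let ?p = "conic_pt e1 e2 e3 p" and ?q = "conic_pt e1 e2 e3 q"
  obtain p1 p2 q1 q2 where pe: "p = (p1, p2)" and qe: "q = (q1, q2)" by (cases p, cases q)
  have d: "p1 * q2 = 1 + q1 * p2" using pq by (simp add: pe qe cross2_def algebra_simps)
  have D: "p1 * q2 - q1 * p2 = 1" using d by simp
  have k: "wform e1 e2 \<noteq> 0" using f by (simp add: conic_frame_def)
  have P: "P = {comb3 e1 e2 e3 A B C | A B C. True}" using f by (simp add: conic_frame_def)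
  have c: "comb3 ?p ?q h A B C = comb3 e1 e2 e3
     (A * p1^2 + B * q1^2 + C * (2 * p1 * q1)) (A * p2^2 + B * q2^2 + C * (2 * p2 * q2))
     (A * (p1 * p2) + B * (q1 * q2) + C * (p1 * q2 + q1 * p2))" for A B C
    by (simp add: comb3_def conic_pt_def h_def pe qe vec_eq_iff algebra_simps)
  \<comment> \<open>Inverse of the substitution in \<open>c\<close>: the symmetric square of the
    adjugate of the matrix with columns p and q. The identities below produce the square of its
    determinant, which is 1.\<close>
  have sub: "comb3 e1 e2 e3 A B C = comb3 ?p ?q h
     (A * q2^2 + B * q1^2 - 2 * C * (q1 * q2)) (A * p2^2 + B * p1^2 - 2 * C * (p1 * p2))
     (C * (p1 * q2 + q1 * p2) - A * (p2 * q2) - B * (p1 * q1))" for A B C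
  proof -
    have "(A * q2^2 + B * q1^2 - 2 * C * (q1 * q2)) * p1^2 + (A * p2^2 + B * p1^2 - 2 * C * (p1 * p2)) * q1^2
        + (C * (p1 * q2 + q1 * p2) - A * (p2 * q2) - B * (p1 * q1)) * (2 * p1 * q1)
        = A * (p1 * q2 - q1 * p2)^2" by algebra
    moreover have "(A * q2^2 + B * q1^2 - 2 * C * (q1 * q2)) * p2^2 + (A * p2^2 + B * p1^2 - 2 * C * (p1 * p2)) * q2^2
        + (C * (p1 * q2 + q1 * p2) - A * (p2 * q2) - B * (p1 * q1)) * (2 * p2 * q2)
        = B * (p1 * q2 - q1 * p2)^2" by algebra
    moreover have "(A * q2^2 + B * q1^2 - 2 * C * (q1 * q2)) * (p1 * p2) + (A * p2^2 + B * p1^2 - 2 * C * (p1 * p2)) * (q1 * q2)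
        + (C * (p1 * q2 + q1 * p2) - A * (p2 * q2) - B * (p1 * q1)) * (p1 * q2 + q1 * p2)
        = C * (p1 * q2 - q1 * p2)^2" by algebra
    ultimately show ?thesis unfolding c D by simp
  qed
  have "P = {comb3 ?p ?q h A B C | A B C. True}"
    unfolding P
  proof (intro equalityI subsetI)
    fix x assume "x \<in> {comb3 e1 e2 e3 A B C | A B C. True}"
    then obtain A B C where x: "x = comb3 e1 e2 e3 A B C" by blast
    show "x \<in> {comb3 ?p ?q h A B C | A B C. True}" unfolding x sub by blast
  next
    fix x assume "x \<in> {comb3 ?p ?q h A B C | A B C. True}"
    then obtain A B C where x: "x = comb3 ?p ?q h A B C" by blast
    show "x \<in> {comb3 e1 e2 e3 A B C | A B C. True}" unfolding x c by blast
  qed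
  moreover have "wform ?p ?q = wform e1 e2"
  proof -
    have "wform ?p ?q = wform e1 e2 * (p1 * q2 - q1 * p2)^2"
      unfolding conic_pt_def wform_comb3[OF f]
      by (simp add: pe qe algebra_simps power2_eq_square)
    then show ?thesis unfolding D by simp
  qed
  moreover have "wform h h = - 2 * wform e1 e2"
  proof -
    have "wform h h = - 2 * (wform e1 e2 * (p1 * q2 - q1 * p2)^2)"
      unfolding h_def wform_comb3[OF f]
      by (simp add: pe qe algebra_simps power2_eq_square)
    then show ?thesis unfolding D by simp
  qed
  moreover have "wform ?p h = 0" "wform ?q h = 0"
    unfolding h_def conic_pt_def wform_comb3[OF f]
    by (simp_all add: pe qe algebra_simps power2_eq_square)
  ultimately show "conic_frame P ?p ?q h"
    unfolding conic_frame_def conic_pt_null[OF f]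
    using k by metis
  obtain r1 r2 where re: "r = (r1, r2)" by (cases r)
  \<comment> \<open>By Cramer's rule, the coordinates of r in the basis p, q.\<close>
  let ?r = "(cross2 r q, cross2 p r)"
  have "(fst r)^2 * q2^2 + (snd r)^2 * q1^2 - 2 * (fst r * snd r) * (q1 * q2) = (fst ?r)^2"
    "(fst r)^2 * p2^2 + (snd r)^2 * p1^2 - 2 * (fst r * snd r) * (p1 * p2) = (snd ?r)^2"
    "(fst r * snd r) * (p1 * q2 + q1 * p2) - (fst r)^2 * (p2 * q2) - (snd r)^2 * (p1 * q1) = fst ?r * snd ?r"
    by (simp_all add: cross2_def pe qe re algebra_simps power2_eq_square)
  then show "conic_pt e1 e2 e3 r = conic_pt ?p ?q h ?r"
    unfolding conic_pt_def[of e1 e2 e3 r] conic_pt_def[of ?p ?q h] sub[of "(fst r)^2"] by simp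
qed

lemma cross2_sl2:
  assumes "cross2 p q = (1::'a::field)"
  shows "cross2 (cross2 r q, cross2 p r) (cross2 s q, cross2 p s) = cross2 r s"
proof -
  have "cross2 (cross2 r q, cross2 p r) (cross2 s q, cross2 p s) = cross2 p q * cross2 r s"
    by (simp add: cross2_def algebra_simps)
  then show ?thesis using assms by simp
qed

lemma exists_cross2_eq_1:
  assumes "p \<noteq> (0, 0::'a::field)"
  shows "\<exists>q. cross2 p q = 1"
proof (cases "fst p = 0")
  case True
  then have "cross2 p (- 1 / snd p, 0) = 1"
    using assms by (cases p) (simp add: cross2_def)
  then show ?thesis by blast
next
  case False
  then have "cross2 p (0, 1 / fst p) = 1" by (simp add: cross2_def)
  then show ?thesis by blast
qed

text \<open>W is a complement of \<open>e1\<close> in P, so subtracting multiples of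
  \<open>e1\<close> moves \<open>e3\<close> and \<open>e2\<close> into it. In the order
  \<open>e3\<close>, \<open>e2\<close>, the projection from \<open>e1\<close> of the point with
  parameter p gets coordinates p.\<close>

lemma frame_complement:
  assumes f: "conic_frame P e1 e2 e3" and dim: "vec.dim P = 3" and P: "vec.subspace P"
    and W: "vec.subspace W" "W \<subseteq> P" "vec.dim W = 2" "e1 \<notin> W"
  obtains k2 k3 where "cbasis2 W (e3 - k3 *s e1) (e2 - k2 *s e1)"
proof -
  have inP: "comb3 e1 e2 e3 A B C \<in> P" for A B C using f by (auto simp: conic_frame_def)
  from inP[of 1 0 0] inP[of 0 1 0] inP[of 0 0 1] have e: "e1 \<in> P" "e2 \<in> P" "e3 \<in> P"
    by (simp_all add: comb3_def)
  have sW: "vec.span W = W" using W(1) by simp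
  have "vec.dim (vec.span (insert e1 W)) = 3"
    using W(3,4) by (simp add: vec.dim_insert sW)
  moreover have "vec.span (insert e1 W) \<subseteq> P"
    using P W(2) e by (intro vec.span_minimal) auto
  ultimately have PW: "vec.span (insert e1 W) = P"
    using dim P by (intro vec.subspace_dim_equal) auto
  obtain k2 where k2: "e2 - k2 *s e1 \<in> W" using e(2) unfolding PW[symmetric] vec.span_breakdown_eq sW ..
  obtain k3 where k3: "e3 - k3 *s e1 \<in> W" using e(3) unfolding PW[symmetric] vec.span_breakdown_eq sW ..
  have ce: "comb (e3 - k3 *s e1) (e2 - k2 *s e1) q
      = comb3 e1 e2 e3 (- (fst q * k3) - snd q * k2) (snd q) (fst q)" for q
    by (simp add: comb_def comb3_def vec_eq_iff algebra_simps)
  have "cbasis2 W (e3 - k3 *s e1) (e2 - k2 *s e1)"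
  proof (rule cbasis2I)
    show "W = range (comb (e3 - k3 *s e1) (e2 - k2 *s e1))"
    proof (intro equalityI subsetI)
      fix w assume w: "w \<in> W"
      then obtain A B C where we: "w = comb3 e1 e2 e3 A B C" using W(2) f by (auto simp: conic_frame_def)
      \<comment> \<open>What remains of \<open>w\<close> after removing the shifted vectors is
        \<open>\<mu>\<close> times \<open>e1\<close>; a nonzero value would put \<open>e1\<close>
        into W.\<close>
      define \<mu> where "\<mu> = A + C * k3 + B * k2"
      have we2: "w - comb (e3 - k3 *s e1) (e2 - k2 *s e1) (C, B) = \<mu> *s e1"
        unfolding we ce \<mu>_def by (simp add: comb3_def vec_eq_iff algebra_simps)
      have "comb (e3 - k3 *s e1) (e2 - k2 *s e1) (C, B) \<in> W"
        unfolding comb_def using k2 k3 W(1) by (intro vec.subspace_add vec.subspace_scale)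
      then have "\<mu> *s e1 \<in> W" using w W(1) we2 by (metis vec.subspace_diff)
      then have "\<mu> = 0" using W(1,4) vec.subspace_scale[of W "\<mu> *s e1" "inverse \<mu>"]
        by (cases "\<mu> = 0") auto
      then have "w = comb (e3 - k3 *s e1) (e2 - k2 *s e1) (C, B)" using we2 by simp
      then show "w \<in> range (comb (e3 - k3 *s e1) (e2 - k2 *s e1))" by blast
    next
      fix w assume "w \<in> range (comb (e3 - k3 *s e1) (e2 - k2 *s e1))"
      then show "w \<in> W"
        unfolding comb_def using k2 k3 W(1) by (clarsimp simp del: vector_ssub_ldistrib)
          (intro vec.subspace_add vec.subspace_scale; assumption)
    qed
    fix q assume "comb (e3 - k3 *s e1) (e2 - k2 *s e1) q = 0"
    then have "comb3 e1 e2 e3 (- (fst q * k3) - snd q * k2) (snd q) (fst q) = comb3 e1 e2 e3 0 0 0"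
      unfolding ce by (simp add: comb3_def)
    then show "q = (0,0)" using comb3_eq_frame[OF f] by (simp add: prod_eq_iff)
  qed
  then show thesis by (rule that)
qed

text \<open>Modulo \<open>e1\<close> the point with parameter (s, t) is t times s e3 + t e2, so its
  join with \<open>e1\<close> meets W in the vector with coordinates (s, t). For t = 0 the point is
  \<open>e1\<close> itself, and the tangent condition kills the \<open>e2\<close> coordinate, which
  again agrees with (s, 0).\<close>

lemma conic_proj_frame:
  assumes f: "conic_frame P e1 e2 e3" and W: "cbasis2 W (e3 - k3 *s e1) (e2 - k2 *s e1)"
    and r: "r \<noteq> 0" and rho: "\<rho> \<noteq> 0" and p: "p \<noteq> (0,0)"
  shows "ppar (conic_proj (r *s e1) W (\<rho> *s conic_pt e1 e2 e3 p))
              (comb (e3 - k3 *s e1) (e2 - k2 *s e1) p)"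
proof -
  let ?f3 = "e3 - k3 *s e1" and ?f2 = "e2 - k2 *s e1"
  let ?c = "r *s e1" and ?x = "\<rho> *s conic_pt e1 e2 e3 p"
  define Q where "Q w \<longleftrightarrow> w \<in> W \<and> w \<noteq> 0 \<and>
      (if (\<exists>t. ?x = t *s ?c) then wform ?c w = 0 else w \<in> vec.span {?c, ?x})" for w
  obtain s t where pe: "p = (s, t)" by (cases p)
  have k: "wform e1 e2 \<noteq> 0" using f by (simp add: conic_frame_def)
  have ce: "comb ?f3 ?f2 q = comb3 e1 e2 e3 (- (fst q * k3) - snd q * k2) (snd q) (fst q)" for q
    by (simp add: comb_def comb3_def vec_eq_iff algebra_simps)
  have c: "?c = comb3 e1 e2 e3 r 0 0" by (simp add: comb3_def)
  have x: "?x = comb3 e1 e2 e3 (\<rho> * s^2) (\<rho> * t^2) (\<rho> * (s * t))"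
    by (simp add: conic_pt_def comb3_def pe vec.scale_right_distrib)
  have cx: "comb ?c ?x m
      = comb3 e1 e2 e3 (fst m * r + snd m * (\<rho> * s^2)) (snd m * (\<rho> * t^2)) (snd m * (\<rho> * (s * t)))" for m
    unfolding x by (simp add: comb_def comb3_def vec_eq_iff algebra_simps)
  have inW: "w \<in> W \<longleftrightarrow> (\<exists>q. w = comb ?f3 ?f2 q)" for w using cbasis2_eq_range[OF W] by auto
  have nz: "comb ?f3 ?f2 p \<noteq> 0" using comb_eq_0_iff[OF W] p by blast
  have tangent: "(\<exists>\<tau>. ?x = \<tau> *s ?c) \<longleftrightarrow> t = 0"
  proof
    assume "\<exists>\<tau>. ?x = \<tau> *s ?c"
    then obtain \<tau> where "?x = \<tau> *s ?c" by blast
    then have "?x = comb3 e1 e2 e3 (\<tau> * r) 0 0" by (simp add: comb3_def)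
    then show "t = 0" using comb3_eq_frame[OF f] rho unfolding x by fastforce
  next
    assume "t = 0"
    then have "?x = (\<rho> * s^2 / r) *s ?c" unfolding x using r by (simp add: comb3_def)
    then show "\<exists>\<tau>. ?x = \<tau> *s ?c" by blast
  qed
  have ex: "Q (comb ?f3 ?f2 p)"
  proof (cases "t = 0")
    case True
    then have "wform ?c (comb ?f3 ?f2 p) = 0" by (simp add: c ce wform_comb3[OF f] pe)
    moreover have "comb ?f3 ?f2 p \<in> W" unfolding inW by (rule exI, rule refl)
    ultimately show ?thesis unfolding Q_def tangent using nz True by simp
  next
    case False
    \<comment> \<open>The second entry turns (t^2, s t) into (t, s); in the first, s^2 / t
      compensates what \<open>?x\<close> then contributes along \<open>e1\<close>.\<close>
    let ?m = "((- (s * k3) - t * k2 - s^2 / t) / r, 1 / (\<rho> * t))"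
    have "fst ?m * r + snd ?m * (\<rho> * s^2) = - (fst p * k3) - snd p * k2"
      "snd ?m * (\<rho> * t^2) = snd p" "snd ?m * (\<rho> * (s * t)) = fst p"
      using False r rho by (simp_all add: pe field_simps power2_eq_square)
    then have "comb ?f3 ?f2 p = comb ?c ?x ?m" unfolding ce cx by simp
    then have "comb ?f3 ?f2 p \<in> vec.span {?c, ?x}" unfolding span_pair_eq_range by blast
    moreover have "comb ?f3 ?f2 p \<in> W" unfolding inW by (rule exI, rule refl)
    ultimately show ?thesis unfolding Q_def tangent using nz False by simp
  qed
  have un: "ppar w (comb ?f3 ?f2 p)" if w: "Q w" for w
  proof -
    obtain q where q: "w = comb ?f3 ?f2 q" using w inW by (auto simp: Q_def)
    have q0: "q \<noteq> (0,0)" using w q by (auto simp: Q_def)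
    have "cross2 q p = 0"
    proof (cases "t = 0")
      case True
      then have "wform ?c w = 0" using w unfolding Q_def tangent by auto
      then have "snd q = 0" unfolding c q ce wform_comb3[OF f] using k r by simp
      then show ?thesis using True by (simp add: cross2_def pe)
    next
      case False
      then obtain m where "w = comb ?c ?x m"
        using w unfolding Q_def tangent span_pair_eq_range by auto
      note comb3_eq_frame[OF f this[unfolded q ce cx]]
      then show ?thesis by (simp add: cross2_def pe power2_eq_square)
    qed
    then show ?thesis unfolding q using ppar_comb_iff[OF W q0 p] by simp
  qed
  have "Q (conic_proj ?c W ?x)"
    unfolding conic_proj_def Q_def[symmetric] using someI[of Q, OF ex] .
  then show ?thesis by (rule un)
qed

text \<open>The centre chosen inside \<open>steiner_cr\<close> is some point of the conic, with
  parameter p. Completing p to a pair of determinant 1 gives a frame starting at the centre.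
  Parameters change by a matrix of determinant 1, so projection yields the cross-ratio of the
  original parameters, whatever centre and line were chosen.\<close>

lemma steiner_cr_frame:
  assumes f: "conic_frame P e1 e2 e3" and P: "vec.subspace P" "vec.dim P = 3"
    and x: "x1 = r1 *s conic_pt e1 e2 e3 p1" "x2 = r2 *s conic_pt e1 e2 e3 p2"
           "x3 = r3 *s conic_pt e1 e2 e3 p3" "x4 = r4 *s conic_pt e1 e2 e3 p4"
    and r: "r1 \<noteq> 0" "r2 \<noteq> 0" "r3 \<noteq> 0" "r4 \<noteq> 0"
    and p: "p1 \<noteq> (0,0)" "p2 \<noteq> (0,0)" "p3 \<noteq> (0,0)" "p4 \<noteq> (0,0)"
  shows "steiner_cr P x1 x2 x3 x4 = cross_ratio2 p1 p2 p3 p4"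
proof -
  define R where "R cW \<longleftrightarrow> fst cW \<in> P \<and> fst cW \<noteq> 0 \<and> wform (fst cW) (fst cW) = 0 \<and>
                        vec.subspace (snd cW) \<and> snd cW \<subseteq> P \<and> vec.dim (snd cW) = 2 \<and>
                        fst cW \<notin> snd cW" for cW
  have inP: "comb3 e1 e2 e3 A B C \<in> P" for A B C using f by (auto simp: conic_frame_def)
  have "R (e1, vec.span {e3, e2})"
  proof -
    have ce: "comb e3 e2 q = comb3 e1 e2 e3 0 (snd q) (fst q)" for q
      by (simp add: comb_def comb3_def)
    have b: "cbasis2 (vec.span {e3, e2}) e3 e2"
    proof (rule cbasis2I)
      fix q assume "comb e3 e2 q = 0"
      then have "comb3 e1 e2 e3 0 (snd q) (fst q) = comb3 e1 e2 e3 0 0 0"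
        unfolding ce by (simp add: comb3_def)
      then show "q = (0,0)" using comb3_eq_frame[OF f] by (simp add: prod_eq_iff)
    qed (rule span_pair_eq_range)
    then have "vec.dim (vec.span {e3, e2}) = 2"
      using vec.dim_span_eq_card_independent[of "{e3, e2}"] by (simp add: cbasis2_def)
    moreover have e1: "e1 = comb3 e1 e2 e3 1 0 0" by (simp add: comb3_def)
    moreover have "e1 \<notin> vec.span {e3, e2}"
    proof
      assume "e1 \<in> vec.span {e3, e2}"
      then obtain q where "e1 = comb3 e1 e2 e3 0 (snd q) (fst q)"
        unfolding span_pair_eq_range ce by auto
      then show False using comb3_eq_frame[OF f, of 1 0 0 0 "snd q" "fst q"] e1 by simp
    qed
    moreover have "vec.span {e3, e2} \<subseteq> P" unfolding span_pair_eq_range ce using inP by auto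
    moreover have "e1 \<noteq> 0" "wform e1 e1 = 0"
      using f by (auto simp: conic_frame_def wform_bilinear)
    moreover have "e1 \<in> P" using inP[of 1 0 0] by (simp add: comb3_def)
    ultimately show ?thesis by (simp add: R_def)
  qed
  then have "R (SOME cW. R cW)" by (rule someI)
  then obtain c W where cW: "(SOME cW. R cW) = (c, W)" and R: "R (c, W)"
    by (metis surj_pair)
  have c: "c \<in> P" "c \<noteq> 0" "wform c c = 0"
    and W: "vec.subspace W" "W \<subseteq> P" "vec.dim W = 2" "c \<notin> W" using R by (auto simp: R_def)
  obtain r p where r0: "r \<noteq> 0" and p0: "p \<noteq> (0,0)" and ce: "c = r *s conic_pt e1 e2 e3 p"
    using frame_null_vector[OF f c] by blast
  obtain q where pq: "cross2 p q = 1" using exists_cross2_eq_1[OF p0] by blast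
  define h1 h2 h3 where h: "h1 = conic_pt e1 e2 e3 p" "h2 = conic_pt e1 e2 e3 q"
    "h3 = comb3 e1 e2 e3 (2 * fst p * fst q) (2 * snd p * snd q) (fst p * snd q + fst q * snd p)"
  have g: "conic_frame P h1 h2 h3" unfolding h by (rule frame_change(1)[OF f pq])
  let ?n = "\<lambda>s. (cross2 s q, cross2 p s)"
  have cp: "conic_pt e1 e2 e3 s = conic_pt h1 h2 h3 (?n s)" for s
    unfolding h by (rule frame_change(2)[OF f pq])
  have n0: "?n s \<noteq> (0,0)" if s: "s \<noteq> (0,0)" for s
  proof
    assume n: "?n s = (0,0)"
    obtain s' where "cross2 s s' = 1" using exists_cross2_eq_1[OF s] by blast
    then have "cross2 (?n s) (?n s') = 1" using cross2_sl2[OF pq] by metis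
    then show False unfolding n by (simp add: cross2_def)
  qed
  have "h1 \<notin> W" using W(1,4) ce unfolding h(1) by (metis vec.subspace_scale)
  then obtain k2 k3 where B: "cbasis2 W (h3 - k3 *s h1) (h2 - k2 *s h1)"
    using frame_complement[OF g P(2,1) W(1-3)] by blast
  let ?C = "comb (h3 - k3 *s h1) (h2 - k2 *s h1)"
  have pr: "ppar (conic_proj c W (\<rho> *s conic_pt e1 e2 e3 s)) (?C (?n s))"
    if "\<rho> \<noteq> 0" "s \<noteq> (0,0)" for \<rho> s
    unfolding ce h(1)[symmetric] cp[of s]
    using conic_proj_frame[OF g B r0 that(1) n0[OF that(2)]] .
  have CW: "?C s \<in> W" for s using cbasis2_eq_range[OF B] by auto
  have lb: "line_basis W" using B by (auto simp: line_basis_def)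
  have "steiner_cr P x1 x2 x3 x4 = cr_on W (conic_proj c W x1) (conic_proj c W x2)
     (conic_proj c W x3) (conic_proj c W x4)"
    unfolding steiner_cr_def R_def[symmetric] by (simp add: cW)
  also have "\<dots> = cr_on W (?C (?n p1)) (?C (?n p2)) (?C (?n p3)) (?C (?n p4))"
    unfolding x by (rule cr_on_ppar[OF lb CW CW CW CW]) (intro pr r p)+
  also have "\<dots> = cross_ratio2 (?n p1) (?n p2) (?n p3) (?n p4)"
    by (rule cr_on_comb[OF B])
  also have "\<dots> = cross_ratio2 p1 p2 p3 p4"
    unfolding cross_ratio2_def cross2_sl2[OF pq] ..
  finally show ?thesis .
qed

section \<open>The quadric of lines meeting both twistor lifts\<close>

lemma wedge_comb:
  "wedge (comb a b p) w = fst p *s wedge a w + snd p *s wedge b w"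
  "wedge v (comb a b p) = fst p *s wedge v a + snd p *s wedge v b"
  by (simp_all add: wedge_def comb_def vec_eq_iff algebra_simps)

lemma wedge_add: "wedge (x + y) z = wedge x z + wedge y z" "wedge x (y + z) = wedge x y + wedge x z"
  by (simp_all add: wedge_def vec_eq_iff algebra_simps)

lemma wedge_scale: "wedge (k *s x) z = k *s wedge x z" "wedge x (k *s z) = k *s wedge x z"
  by (simp_all add: wedge_def vec_eq_iff algebra_simps)

lemma wedge_self [simp]: "wedge x x = 0"
  by (simp add: wedge_def vec_eq_iff)

lemma wedge_commute: "wedge y x = - wedge x y"
  by (simp add: wedge_def vec_eq_iff)

lemma wform_minus: "wform (- x) y = - wform x y" "wform x (- y) = - wform x y"
  by (simp_all add: wform_def)

lemma wform_wedge_repeat: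
  "wform (wedge x y) (wedge x z) = 0" "wform (wedge x y) (wedge z x) = 0"
  "wform (wedge y x) (wedge x z) = 0" "wform (wedge y x) (wedge z x) = 0"
  by (simp_all add: wform_def wedge_def algebra_simps)

lemma antisym_wedge: "antisym_bv (wedge v w)"
  by (simp add: antisym_bv_def wedge_def)

lemma antisym_bv_lin:
  assumes "antisym_bv x"
  shows "antisym_bv y \<Longrightarrow> antisym_bv (x + y)" "antisym_bv y \<Longrightarrow> antisym_bv (x - y)"
    "antisym_bv (k *s x)"
proof -
  have x: "x $ (i, j) = - x $ (j, i)" for i j using assms unfolding antisym_bv_def by blast
  show "antisym_bv (k *s x)" unfolding antisym_bv_def
  proof (intro allI)
    fix i j show "(k *s x) $ (i, j) = - (k *s x) $ (j, i)" using x[of i j] by simp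
  qed
  assume "antisym_bv y"
  then have y: "y $ (i, j) = - y $ (j, i)" for i j unfolding antisym_bv_def by blast
  show "antisym_bv (x + y)" unfolding antisym_bv_def
  proof (intro allI)
    fix i j show "(x + y) $ (i, j) = - (x + y) $ (j, i)" using x[of i j] y[of i j] by simp
  qed
  show "antisym_bv (x - y)" unfolding antisym_bv_def
  proof (intro allI)
    fix i j show "(x - y) $ (i, j) = - (x - y) $ (j, i)" using x[of i j] y[of i j] by simp
  qed
qed

text \<open>Pairing with the wedge of two coordinate axes reads off, up to sign, the complementary
  coordinate; antisymmetry supplies the remaining entries.\<close>

lemma wform_nondegenerate:
  assumes a: "antisym_bv \<alpha>" and z: "\<And>v w. wform \<alpha> (wedge v w) = 0"
  shows "\<alpha> = 0"
proof -
  have d: "\<alpha> $ (i, i) = 0" for i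
  proof -
    have "\<alpha> $ (i, i) = - \<alpha> $ (i, i)" using a unfolding antisym_bv_def by blast
    then show ?thesis by simp
  qed
  have s: "\<alpha> $ (j, i) = 0" if "\<alpha> $ (i, j) = 0" for i j using that a unfolding antisym_bv_def by (metis minus_zero)
  note e = z[of "axis i 1" "axis j 1" for i j, unfolded wform_def wedge_def]
  have "\<alpha>$(1,2) = 0" "\<alpha>$(1,3) = 0" "\<alpha>$(1,4) = 0" "\<alpha>$(2,3) = 0" "\<alpha>$(2,4) = 0" "\<alpha>$(3,4) = 0"
    using e[of 3 4] e[of 2 4] e[of 2 3] e[of 1 4] e[of 1 3] e[of 1 2]
    by (simp_all add: axis_def)
  then have "\<alpha> $ (i, j) = 0" for i j
    using exhaust_4[of i] exhaust_4[of j] d s[of 1 2] s[of 1 3] s[of 1 4] s[of 2 3] s[of 2 4] s[of 3 4]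
    by auto
  then show ?thesis by (simp add: vec_eq_iff)
qed

lemma wedge_eq_0_imp:
  assumes "wedge v w = 0" "v \<noteq> 0"
  shows "\<exists>k. w = k *s v"
proof -
  obtain i where i: "v $ i \<noteq> 0" using assms(2) by (auto simp: vec_eq_iff)
  have "v $ i * w $ j = v $ j * w $ i" for j
  proof -
    have "wedge v w $ (i, j) = 0" using assms(1) by simp
    then show ?thesis by (simp add: wedge_def)
  qed
  then have "w = (w $ i / v $ i) *s v" using i by (simp add: vec_eq_iff field_simps)
  then show ?thesis by blast
qed

lemma plk_basis:
  assumes ab: "cbasis2 L a b"
  shows "\<exists>k. k \<noteq> 0 \<and> plk L = k *s wedge a b"
proof -
  define ab' where "ab' = (SOME ab. cbasis2 L (fst ab) (snd ab))"
  have "cbasis2 L (fst ab') (snd ab')" unfolding ab'_def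
    by (rule someI[of _ "(a, b)"]) (simp add: ab)
  then obtain c d where cd: "ab' = (c, d)" and L': "cbasis2 L c d" by (cases ab') auto
  have "comb c d (1, 0) \<in> L" "comb c d (0, 1) \<in> L" using cbasis2_eq_range[OF L'] by auto
  then obtain m n where m: "c = comb a b m" and n: "d = comb a b n"
    using cbasis2_eq_range[OF ab] by (auto simp: comb_def)
  have "m \<noteq> (0,0)" "n \<noteq> (0,0)" using comb_eq_0_iff[OF L', of "(1,0)"] comb_eq_0_iff[OF L', of "(0,1)"] m n
    by (auto simp: comb_def)
  moreover have "\<not> ppar c d"
    using ppar_comb_iff[OF L', of "(1,0)" "(0,1)"] by (simp add: comb_def cross2_def)
  ultimately have "cross2 m n \<noteq> 0" unfolding m n by (simp add: ppar_comb_iff[OF ab])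
  moreover have "wedge c d = cross2 m n *s wedge a b"
    unfolding m n wedge_comb cross2_def
    by (simp add: wedge_def vec_eq_iff algebra_simps)
  moreover have "plk L = wedge c d" unfolding plk_def ab'_def[symmetric] by (simp add: cd)
  ultimately show ?thesis by auto
qed

text \<open>A 2x2 matrix of rank one is a column times a row. Applied to the coordinates of a
  bivector, this is the Segre decomposition of Q^2_S.\<close>

lemma rank_one_tensor:
  assumes "A * D = B * (C::'a::field)" "(A, B, C, D) \<noteq> (0,0,0,0)"
  shows "\<exists>p q. p \<noteq> (0,0) \<and> q \<noteq> (0,0) \<and> A = fst p * fst q \<and> B = fst p * snd q
      \<and> C = snd p * fst q \<and> D = snd p * snd q"
proof (cases "(A, B) = (0, 0)")
  case True
  then show ?thesis using assms by (intro exI[of _ "(0,1)"] exI[of _ "(C,D)"]) auto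
next
  case False
  have "cross2 (C, D) (A, B) = 0" using assms(1) by (simp add: cross2_def algebra_simps)
  from cross2_zero_imp_prop[OF this False] obtain k where "(C, D) = (k * A, k * B)" by auto
  then show ?thesis using False by (intro exI[of _ "(1,k)"] exI[of _ "(A,B)"]) auto
qed

lemma jmap_nth: "jmap v $ 1 = - cnj (v $ 2)" "jmap v $ 2 = cnj (v $ 1)"
  "jmap v $ 3 = - cnj (v $ 4)" "jmap v $ 4 = cnj (v $ 3)"
  by (simp_all add: jmap_def vector_def)

text \<open>The hypotheses on S serve only to produce these bases of the two lifts and the
  decomposition of C^4; everything about Q^2_S is derived from them.\<close>

locale twistor_pair =
  fixes S :: "complex^4^4" and a b c d :: c4
  assumes ab: "cbasis2 (twistor_lift S) a b"
    and cd: "cbasis2 (jmap ` twistor_lift S) c d"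
    and total: "\<And>v. \<exists>p q. v = comb a b p + comb c d q"
begin

definition K :: complex where "K = wform (wedge a b) (wedge c d)"

lemma pairings:
  "wform (wedge a c) (wedge b d) = - K" "wform (wedge b d) (wedge a c) = - K"
  "wform (wedge a d) (wedge b c) = K" "wform (wedge b c) (wedge a d) = K"
  "wform (wedge a b) (wedge c d) = K" "wform (wedge c d) (wedge a b) = K"
  by (simp_all add: K_def wform_def wedge_def algebra_simps)

text \<open>By \<open>total\<close>, every \<open>wedge v w\<close> is a combination of wedges of
  basis vectors, and among these \<open>wedge a b\<close> can pair nontrivially only with
  \<open>wedge c d\<close>. If that product vanished too, nondegeneracy would force
  \<open>wedge a b = 0\<close>.\<close>

lemma K_nonzero: "K \<noteq> 0"
proof
  assume K: "K = 0"
  have "wform (wedge a b) (wedge v w) = 0" for v w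
  proof -
    obtain p q p' q' where "v = comb a b p + comb c d q" "w = comb a b p' + comb c d q'"
      using total by meson
    then show ?thesis
      using K pairings by (simp add: wedge_add wedge_comb wform_bilinear wform_wedge_repeat wform_minus
           wedge_commute[of c d])
  qed
  then have "wedge a b = 0" using wform_nondegenerate antisym_wedge by blast
  moreover have "a \<noteq> 0" using comb_eq_0_iff[OF ab, of "(1,0)"] by (simp add: comb_def)
  ultimately obtain k where "b = k *s a" using wedge_eq_0_imp by blast
  then have "comb a b (k, -1) = 0" by (simp add: comb_def)
  then show False using comb_eq_0_iff[OF ab] by simp
qed

text \<open>The line joining the points with coordinates p on the lift and q on its image under j:
  the Segre embedding of a product of two projective lines.\<close>

definition ray :: "complex \<times> complex \<Rightarrow> complex \<times> complex \<Rightarrow> bv" where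
  "ray p q = wedge (comb a b p) (comb c d q)"

lemma ray_expand: "ray p q = (fst p * fst q) *s wedge a c + (fst p * snd q) *s wedge a d
      + (snd p * fst q) *s wedge b c + (snd p * snd q) *s wedge b d"
  by (simp add: ray_def wedge_comb vec.scale_right_distrib algebra_simps)

text \<open>Two such lines meet exactly when they share their point on one of the lifts; hence a
  product of two determinants.\<close>

lemma wform_ray: "wform (ray p q) (ray p' q') = - K * cross2 p p' * cross2 q q'"
  by (simp add: ray_expand wform_bilinear wform_wedge_repeat pairings cross2_def algebra_simps)

lemma ray_nonzero: "p \<noteq> (0,0) \<Longrightarrow> q \<noteq> (0,0) \<Longrightarrow> ray p q \<noteq> 0"
proof
  assume p: "p \<noteq> (0,0)" "q \<noteq> (0,0)" and 0: "ray p q = 0"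
  obtain p' q' where "cross2 p p' = 1" "cross2 q q' = 1" using exists_cross2_eq_1 p by meson
  then show False using wform_ray[of p q p' q'] 0 K_nonzero by (simp add: wform_bilinear)
qed

lemma ray_scale: "k *s ray p q = ray (k * fst p, k * snd p) q"
  by (simp add: ray_expand vec.scale_right_distrib algebra_simps)

text \<open>Orthogonality to \<open>wedge a b\<close> and \<open>wedge c d\<close> leaves the four
  mixed coordinates. On them the quadratic form is, up to a factor, the determinant of a 2x2 matrix,
  so its null vectors factor.\<close>

lemma Q2S_iff: "Q2S S \<alpha> \<longleftrightarrow> (\<exists>p q. p \<noteq> (0,0) \<and> q \<noteq> (0,0) \<and> \<alpha> = ray p q)"
proof -
  obtain k l where k: "k \<noteq> 0" "plk (twistor_lift S) = k *s wedge a b"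
    and l: "l \<noteq> 0" "plk (jmap ` twistor_lift S) = l *s wedge c d"
    using plk_basis[OF ab] plk_basis[OF cd] by blast
  have Q: "Q2S S \<alpha> \<longleftrightarrow> inQ4 \<alpha> \<and> wform \<alpha> (wedge a b) = 0 \<and> wform \<alpha> (wedge c d) = 0"
    by (simp add: Q2S_def k l wform_bilinear)
  show ?thesis
  proof
    assume "Q2S S \<alpha>"
    then have \<alpha>: "\<alpha> \<noteq> 0" "antisym_bv \<alpha>" "wform \<alpha> \<alpha> = 0" "wform \<alpha> (wedge a b) = 0" "wform \<alpha> (wedge c d) = 0"
      by (auto simp: Q inQ4_def)
    \<comment> \<open>\<open>wedge a c\<close> is dual to \<open>wedge b d\<close>, and
      \<open>wedge a d\<close> to \<open>wedge b c\<close>; the coefficients are read off by pairing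
      with the dual bivector, with the signs of \<open>pairings\<close>.\<close>
    define A B C D where ABCD: "A = - wform \<alpha> (wedge b d) / K" "B = wform \<alpha> (wedge b c) / K"
      "C = wform \<alpha> (wedge a d) / K" "D = - wform \<alpha> (wedge a c) / K"
    define \<beta> where "\<beta> = A *s wedge a c + B *s wedge a d + C *s wedge b c + D *s wedge b d"
    have an: "antisym_bv (\<alpha> - \<beta>)" unfolding \<beta>_def by (intro antisym_bv_lin antisym_wedge \<alpha>(2))
    have w: "wform (\<alpha> - \<beta>) (wedge a b) = 0" "wform (\<alpha> - \<beta>) (wedge c d) = 0"
       "wform (\<alpha> - \<beta>) (wedge a c) = 0" "wform (\<alpha> - \<beta>) (wedge a d) = 0"
       "wform (\<alpha> - \<beta>) (wedge b c) = 0" "wform (\<alpha> - \<beta>) (wedge b d) = 0"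
      using K_nonzero \<alpha>(4,5)
      by (simp_all add: \<beta>_def wform_bilinear wform_wedge_repeat pairings ABCD)
    have "wform (\<alpha> - \<beta>) (wedge v w) = 0" for v w
    proof -
      obtain p q p' q' where "v = comb a b p + comb c d q" "w = comb a b p' + comb c d q'"
        using total by meson
      then show ?thesis
        using w by (simp only: wedge_add wedge_comb wform_bilinear(2,4) wform_minus
           wedge_commute[of b a] wedge_commute[of d c] wedge_commute[of c a] wedge_commute[of d a]
           wedge_commute[of c b] wedge_commute[of d b] wedge_self wform_bilinear(8) mult_zero_right add_0 minus_zero)
    qed
    then have "\<alpha> - \<beta> = 0" using an wform_nondegenerate by blast
    then have \<alpha>\<beta>: "\<alpha> = \<beta>" by simp
    have "wform \<alpha> (wedge b d) = - (K * A)" "wform \<alpha> (wedge b c) = K * B"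
      "wform \<alpha> (wedge a d) = K * C" "wform \<alpha> (wedge a c) = - (K * D)"
      using K_nonzero by (simp_all add: ABCD)
    then have "wform \<alpha> \<beta> = A * - (K * D) + B * (K * C) + C * (K * B) + D * - (K * A)"
      unfolding \<beta>_def wform_bilinear by simp
    then have "wform \<alpha> \<beta> = 2 * K * (B * C - A * D)" by (simp add: algebra_simps)
    then have "A * D = B * C" using \<alpha>(3) \<alpha>\<beta> K_nonzero by simp
    moreover have "(A, B, C, D) \<noteq> (0,0,0,0)" using \<alpha>(1) \<alpha>\<beta> by (auto simp: \<beta>_def)
    ultimately have "\<exists>p q. p \<noteq> (0,0) \<and> q \<noteq> (0,0) \<and> A = fst p * fst q \<and> B = fst p * snd q
      \<and> C = snd p * fst q \<and> D = snd p * snd q" by (rule rank_one_tensor)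
    then obtain p q where pq: "p \<noteq> (0,0)" "q \<noteq> (0,0)" "A = fst p * fst q" "B = fst p * snd q"
      "C = snd p * fst q" "D = snd p * snd q" by (elim exE conjE)
    have "\<alpha> = ray p q" unfolding \<alpha>\<beta> \<beta>_def ray_expand pq(3-6) ..
    then show "\<exists>p q. p \<noteq> (0,0) \<and> q \<noteq> (0,0) \<and> \<alpha> = ray p q" using pq(1,2) by (intro exI conjI)
  next
    assume "\<exists>p q. p \<noteq> (0,0) \<and> q \<noteq> (0,0) \<and> \<alpha> = ray p q"
    then obtain p q where pq: "p \<noteq> (0,0)" "q \<noteq> (0,0)" "\<alpha> = ray p q" by blast
    have "wform \<alpha> \<alpha> = 0" unfolding pq wform_ray by (simp add: cross2_def)
    moreover have "wform \<alpha> (wedge a b) = 0" "wform \<alpha> (wedge c d) = 0"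
      unfolding pq ray_expand by (simp_all add: wform_bilinear wform_wedge_repeat)
    moreover have "\<alpha> \<noteq> 0" "antisym_bv \<alpha>"
      using pq ray_nonzero antisym_wedge by (auto simp: ray_def)
    ultimately show "Q2S S \<alpha>" unfolding Q inQ4_def by blast
  qed
qed

lemma Q2S_scale: "Q2S S \<alpha> \<Longrightarrow> k \<noteq> 0 \<Longrightarrow> Q2S S (k *s \<alpha>)"
  unfolding Q2S_iff 
proof -
  assume "\<exists>p q. p \<noteq> (0,0) \<and> q \<noteq> (0,0) \<and> \<alpha> = ray p q" "k \<noteq> 0"
  then obtain p q where "p \<noteq> (0,0)" "q \<noteq> (0,0)" "\<alpha> = ray p q" by blast
  then show "\<exists>p q. p \<noteq> (0,0) \<and> q \<noteq> (0,0) \<and> k *s \<alpha> = ray p q"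
    using \<open>k \<noteq> 0\<close> by (intro exI[of _ "(k * fst p, k * snd p)"] exI[of _ q]) (auto simp: ray_scale prod_eq_iff)
qed


text \<open>\<open>piS\<close> is only known to return some point v of the lift on the line. Every
  \<open>ray\<close> through v then meets \<open>ray p q\<close>; for one whose other end differs
  from q, \<open>wform_ray\<close> can vanish only if v is proportional to
  \<open>comb a b p\<close>.\<close>

lemma piS_ray:
  assumes p: "p \<noteq> (0,0)" and q: "q \<noteq> (0,0)"
  shows "ppar (piS S (ray p q)) (comb a b p)" "piS S (ray p q) \<in> twistor_lift S"
proof -
  define R where "R v \<longleftrightarrow> v \<noteq> 0 \<and> v \<in> twistor_lift S \<and> in_line v (ray p q)" for v
  have "in_line (comb a b p) (ray p q)"
    unfolding in_line_def ray_def
    by (intro exI[of _ 1] exI[of _ 0] exI[of _ "comb a b p"] exI[of _ "comb c d q"]) simp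
  then have "R (comb a b p)"
    unfolding R_def using comb_eq_0_iff[OF ab] p cbasis2_eq_range[OF ab] by blast
  then have R: "R (piS S (ray p q))" unfolding piS_def R_def[symmetric] by (rule someI)
  then show m: "piS S (ray p q) \<in> twistor_lift S" by (simp add: R_def)
  then obtain p' where p': "piS S (ray p q) = comb a b p'" using cbasis2_eq_range[OF ab] by blast
  have p0: "p' \<noteq> (0,0)" using R p' by (auto simp: R_def)
  obtain q' where q': "cross2 q q' = 1" using exists_cross2_eq_1[OF q] by blast
  obtain x y w1 w2 where w: "ray p q = wedge w1 w2" "comb a b p' = x *s w1 + y *s w2"
    using R unfolding R_def p' in_line_def by blast
  have "wform (ray p q) (ray p' q') = 0"
    unfolding ray_def[of p'] w
    by (simp add: wedge_add wedge_scale wform_bilinear wform_wedge_repeat)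
  then have "cross2 p p' = 0" unfolding wform_ray using q' K_nonzero by simp
  then have "cross2 p' p = 0" by (simp add: cross2_def algebra_simps)
  then show "ppar (piS S (ray p q)) (comb a b p)"
    unfolding p' using ppar_comb_iff[OF ab p0 p] by simp
qed

lemma piS_mem: "Q2S S \<alpha> \<Longrightarrow> piS S \<alpha> \<in> twistor_lift S" "Q2S S \<alpha> \<Longrightarrow> piS S \<alpha> \<noteq> 0"
  unfolding Q2S_iff using piS_ray by (auto simp: ppar_def)

lemma piS_ppar:
  assumes "Q2S S \<alpha>" "ppar \<alpha> \<beta>"
  shows "ppar (piS S \<alpha>) (piS S \<beta>)"
proof -
  obtain p q where pq: "p \<noteq> (0,0)" "q \<noteq> (0,0)" "\<alpha> = ray p q" using assms Q2S_iff by blast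
  obtain k where k: "\<beta> = k *s \<alpha>" "k \<noteq> 0" using ppar_sym[OF assms(2)] by (auto simp: ppar_def)
  let ?p = "(k * fst p, k * snd p)"
  have p': "?p \<noteq> (0,0)" using pq(1) k by (auto simp: prod_eq_iff)
  have "ppar (piS S \<beta>) (comb a b ?p)" unfolding k pq ray_scale using piS_ray(1)[OF p' pq(2)] .
  moreover have "ppar (comb a b ?p) (comb a b p)"
    unfolding ppar_comb_iff[OF ab p' pq(1)] by (simp add: cross2_def)
  moreover have "ppar (piS S \<alpha>) (comb a b p)" unfolding pq using piS_ray(1) pq by blast
  ultimately show ?thesis by (meson ppar_sym ppar_trans)
qed

lemma real_pt_Q2S:
  assumes v: "v \<in> twistor_lift S" "v \<noteq> 0"
  shows "Q2S S (real_pt v)" "ppar (piS S (real_pt v)) v"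
proof -
  obtain p where p: "v = comb a b p" using cbasis2_eq_range[OF ab] v by blast
  obtain q where q: "jmap v = comb c d q" using cbasis2_eq_range[OF cd] v by blast
  have "jmap v \<noteq> 0"
  proof
    assume 0: "jmap v = 0"
    have "jmap v $ i = 0" for i unfolding 0 by simp
    from this[of 1] this[of 2] this[of 3] this[of 4] have "v = 0"
      by (simp add: jmap_nth vec_eq_iff forall_4)
    then show False using v by simp
  qed
  then have n: "p \<noteq> (0,0)" "q \<noteq> (0,0)" using v p q by auto
  have r: "real_pt v = ray p q" by (simp add: real_pt_def ray_def q p[symmetric])
  show "Q2S S (real_pt v)" unfolding r Q2S_iff using n by blast
  show "ppar (piS S (real_pt v)) v" unfolding r using piS_ray(1)[OF n] by (simp add: p)
qed

end

section \<open>Irreducible plane sections of Q^2_S as graphs of projectivities\<close>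

lemma basis_change:
  assumes ab: "cbasis2 L a b" and pq: "cross2 p q \<noteq> 0"
  shows "cbasis2 L (comb a b p) (comb a b q)"
proof (rule cbasis2I)
  have ch: "comb (comb a b p) (comb a b q) r
      = comb a b (fst r * fst p + snd r * fst q, fst r * snd p + snd r * snd q)" for r
    by (simp add: comb_def vec_eq_iff algebra_simps)
  show "L = range (comb (comb a b p) (comb a b q))"
  proof (intro equalityI subsetI)
    fix x assume "x \<in> L"
    then obtain r where r: "x = comb a b r" using cbasis2_eq_range[OF ab] by blast
    have "x = comb (comb a b p) (comb a b q) (cross2 r q / cross2 p q, cross2 p r / cross2 p q)"
    proof -
      have "cross2 r q * fst p + cross2 p r * fst q = cross2 p q * fst r"
        "cross2 r q * snd p + cross2 p r * snd q = cross2 p q * snd r"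
        by (simp_all add: cross2_def algebra_simps)
      then show ?thesis unfolding ch r using pq
        by (simp add: add_divide_distrib[symmetric])
    qed
    then show "x \<in> range (comb (comb a b p) (comb a b q))" by (rule range_eqI)
  next
    fix x assume "x \<in> range (comb (comb a b p) (comb a b q))"
    then show "x \<in> L" unfolding ch cbasis2_eq_range[OF ab] by blast
  qed
  fix r assume "comb (comb a b p) (comb a b q) r = 0"
  then have e: "fst r * fst p + snd r * fst q = 0" "fst r * snd p + snd r * snd q = 0"
    unfolding ch comb_eq_0_iff[OF ab] by simp_all
  have "fst r * cross2 p q = (fst r * fst p + snd r * fst q) * snd q - (fst r * snd p + snd r * snd q) * fst q"
    "snd r * cross2 p q = (fst r * snd p + snd r * snd q) * fst p - (fst r * fst p + snd r * fst q) * snd p"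
    by (simp_all add: cross2_def algebra_simps)
  then show "r = (0,0)" unfolding e using pq by (simp add: prod_eq_iff)
qed

text \<open>If x and y were orthogonal, \<open>(wform y z) *s x - (wform x z) *s y\<close> would be
  orthogonal to x, y and z, hence zero. Then z is orthogonal to both, and x lies in the radical of
  the form on P.\<close>

lemma null_triple_pairing:
  assumes P: "P = {comb3 x y z A B C | A B C. True}"
    and nondeg: "\<And>v. v \<in> P \<Longrightarrow> (\<And>w. w \<in> P \<Longrightarrow> wform v w = 0) \<Longrightarrow> v = 0"
    and ind: "\<And>A B C. comb3 x y z A B C = 0 \<Longrightarrow> A = 0 \<and> B = 0 \<and> C = 0"
    and null: "wform x x = 0" "wform y y = 0" "wform z z = 0"
  shows "wform x y \<noteq> 0"
proof
  assume xy: "wform x y = 0"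
  have yx: "wform y x = 0" using xy by (simp add: wform_commute)
  have "comb3 x y z (wform y z) (- wform x z) 0 = 0"
  proof (rule nondeg)
    fix w assume "w \<in> P"
    then obtain A B C where "w = comb3 x y z A B C" using P by blast
    then show "wform (comb3 x y z (wform y z) (- wform x z) 0) w = 0"
      by (simp add: comb3_def wform_bilinear null xy yx)
  qed (use P in blast)
  then have xz: "wform x z = 0" using ind by fastforce
  have "comb3 x y z 1 0 0 = 0"
  proof (rule nondeg)
    fix w assume "w \<in> P"
    then obtain A B C where "w = comb3 x y z A B C" using P by blast
    then show "wform (comb3 x y z 1 0 0) w = 0"
      by (simp add: comb3_def wform_bilinear null xy xz)
  qed (use P in blast)
  then show False using ind by fastforce
qed

lemma (in twistor_pair) basis_change_pair:
  assumes "cross2 p p' \<noteq> 0" "cross2 q q' \<noteq> 0"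
  shows "twistor_pair S (comb a b p) (comb a b p') (comb c d q) (comb c d q')"
proof
  show ab': "cbasis2 (twistor_lift S) (comb a b p) (comb a b p')" by (rule basis_change[OF ab assms(1)])
  show cd': "cbasis2 (jmap ` twistor_lift S) (comb c d q) (comb c d q')" by (rule basis_change[OF cd assms(2)])
  fix v obtain r s where "v = comb a b r + comb c d s" using total by blast
  moreover have "comb a b r \<in> range (comb (comb a b p) (comb a b p'))"
    using cbasis2_eq_range[OF ab] cbasis2_eq_range[OF ab'] by blast
  moreover have "comb c d s \<in> range (comb (comb c d q) (comb c d q'))"
    using cbasis2_eq_range[OF cd] cbasis2_eq_range[OF cd'] by blast
  ultimately show "\<exists>r s. v = comb (comb a b p) (comb a b p') r + comb (comb c d q) (comb c d q') s"
    by (metis imageE)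
qed

text \<open>The conic is the graph u \<mapsto> u \<and> g u of a projective isomorphism g between
the two twistor lifts; here g is the isomorphism matching the bases (a, b) and (c, d).\<close>

locale twistor_conic = twistor_pair +
  fixes P :: "bv set"
  assumes frame: "conic_frame P (wedge a c) (wedge b d) (wedge a d + wedge b c)"
    and plane: "vec.subspace P" "vec.dim P = 3"
begin

text \<open>Wedging s a + t b with s c + t d gives coefficients s^2, t^2 and s t, which explains the
  third frame vector \<open>wedge a d + wedge b c\<close>. The conic parameter is thereby the
  coordinate on both lifts at once.\<close>

lemma conic_pt_ray: "conic_pt (wedge a c) (wedge b d) (wedge a d + wedge b c) p = ray p p"
  by (simp add: conic_pt_def comb3_def ray_expand power2_eq_square vec.scale_right_distrib algebra_simps)

lemma point_on_conic:
  assumes "Q2S S x" "x \<in> P"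
  shows "\<exists>r p. r \<noteq> 0 \<and> p \<noteq> (0,0) \<and> x = r *s ray p p"
  using frame_null_vector[OF frame assms(2)] assms(1) unfolding conic_pt_ray Q2S_def inQ4_def by blast

lemma ray_in_P: "ray p p \<in> P"
  using conic_pt_in[OF frame, of 1] unfolding conic_pt_ray by simp

lemma piS_conic:
  assumes "r \<noteq> 0" "p \<noteq> (0,0)"
  shows "ppar (piS S (r *s ray p p)) (comb a b p)"
proof -
  have "Q2S S (ray p p)" unfolding Q2S_iff using assms by blast
  then have "ppar (piS S (r *s ray p p)) (piS S (ray p p))"
    using assms ray_nonzero by (intro piS_ppar Q2S_scale ppar_scale) auto
  then show ?thesis using piS_ray(1)[OF assms(2,2)] by (rule ppar_trans)
qed

lemma steiner_eq_cr:
  assumes Q: "Q2S S x1" "Q2S S x2" "Q2S S x3" "Q2S S x4"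
    and P: "x1 \<in> P" "x2 \<in> P" "x3 \<in> P" "x4 \<in> P"
  shows "steiner_cr P x1 x2 x3 x4
    = cr_on (twistor_lift S) (piS S x1) (piS S x2) (piS S x3) (piS S x4)"
proof -
  obtain r1 p1 where 1: "r1 \<noteq> 0" "p1 \<noteq> (0,0)" "x1 = r1 *s ray p1 p1" using point_on_conic Q(1) P(1) by blast
  obtain r2 p2 where 2: "r2 \<noteq> 0" "p2 \<noteq> (0,0)" "x2 = r2 *s ray p2 p2" using point_on_conic Q(2) P(2) by blast
  obtain r3 p3 where 3: "r3 \<noteq> 0" "p3 \<noteq> (0,0)" "x3 = r3 *s ray p3 p3" using point_on_conic Q(3) P(3) by blast
  obtain r4 p4 where 4: "r4 \<noteq> 0" "p4 \<noteq> (0,0)" "x4 = r4 *s ray p4 p4" using point_on_conic Q(4) P(4) by blast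
  have m: "comb a b p \<in> twistor_lift S" for p using cbasis2_eq_range[OF ab] by blast
  have "cr_on (twistor_lift S) (piS S x1) (piS S x2) (piS S x3) (piS S x4)
     = cr_on (twistor_lift S) (comb a b p1) (comb a b p2) (comb a b p3) (comb a b p4)"
    unfolding 1(3) 2(3) 3(3) 4(3)
    by (intro cr_on_ppar m piS_conic 1 2 3 4) (use ab line_basis_def in blast)
  also have "\<dots> = cross_ratio2 p1 p2 p3 p4" by (rule cr_on_comb[OF ab])
  also have "\<dots> = steiner_cr P x1 x2 x3 x4"
    by (rule steiner_cr_frame[OF frame plane, unfolded conic_pt_ray, OF 1(3) 2(3) 3(3) 4(3)
       1(1) 2(1) 3(1) 4(1) 1(2) 2(2) 3(2) 4(2), symmetric])
  finally show ?thesis ..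
qed

text \<open>On all of Q^2_S the projection forgets the second factor; on the diagonal points
  \<open>ray p p\<close> of one conic nothing is lost, since scaling p by k scales
  \<open>ray p p\<close> by k^2.\<close>

lemma piS_inj:
  assumes Q: "Q2S S x" "Q2S S y" and P: "x \<in> P" "y \<in> P"
    and e: "ppar (piS S x) (piS S y)"
  shows "ppar x y"
proof -
  obtain r p where 1: "r \<noteq> 0" "p \<noteq> (0,0)" "x = r *s ray p p" using point_on_conic Q(1) P(1) by blast
  obtain s q where 2: "s \<noteq> 0" "q \<noteq> (0,0)" "y = s *s ray q q" using point_on_conic Q(2) P(2) by blast
  have "ppar (comb a b p) (comb a b q)"
    using ppar_trans[OF ppar_trans[OF ppar_sym[OF piS_conic[OF 1(1,2)]] e[unfolded 1(3) 2(3)]]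
      piS_conic[OF 2(1,2)]] .
  then have "cross2 p q = 0" using ppar_comb_iff[OF ab 1(2) 2(2)] by blast
  then obtain k where k: "p = (k * fst q, k * snd q)" using cross2_zero_imp_prop[OF _ 2(2)] by blast
  have "ray p p = (k * k) *s ray q q"
    by (subst k, subst k) (simp add: ray_expand vec.scale_right_distrib algebra_simps)
  then have "x = (r * (k * k) / s) *s y" unfolding 1(3) 2(3) using 2(1) by simp
  moreover have "x \<noteq> 0" "y \<noteq> 0" using Q by (auto simp: Q2S_def inQ4_def)
  ultimately show ?thesis unfolding ppar_def by blast
qed

lemma piS_onto:
  assumes v: "v \<in> twistor_lift S" "v \<noteq> 0"
  shows "\<exists>x\<in>P. Q2S S x \<and> ppar (piS S x) v"
proof -
  obtain p where p: "v = comb a b p" using v cbasis2_eq_range[OF ab] by blast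
  have "p \<noteq> (0,0)" using v p by auto
  then show ?thesis
    using ray_in_P piS_ray(1) p unfolding Q2S_iff by blast
qed

end

context twistor_pair
begin

text \<open>Three independent spanning points are pairwise non-incident, so their ends on each lift
  are distinct. Rescaling makes the third end the sum of the first two on both lifts, as when a
  projectivity is fixed by three points. In the new bases the points have parameters (1, 0), (0, 1)
  and (1, 1).\<close>

lemma irreducible_plane_is_twistor_conic:
  assumes P: "irreducible_conic_plane P" and X: "P = vec.span X" "\<And>x. x \<in> X \<Longrightarrow> Q2S S x"
  shows "\<exists>u1 u2 w1 w2. twistor_conic S u1 u2 w1 w2 P"
proof -
  have plane: "vec.subspace P" "vec.dim P = 3"
    and nondeg: "\<And>v. v \<in> P \<Longrightarrow> (\<And>w. w \<in> P \<Longrightarrow> wform v w = 0) \<Longrightarrow> v = 0"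
    using P by (auto simp: irreducible_conic_plane_def)
  obtain B where B: "B \<subseteq> X" "vec.independent B" "X \<subseteq> vec.span B" "card B = vec.dim X"
    using vec.basis_exists by blast
  have "card B = 3" using B(4) plane(2) by (simp add: X(1))
  then obtain x1 x2 x3 where B3: "B = {x1, x2, x3}" and ne: "x1 \<noteq> x2" "x1 \<noteq> x3" "x2 \<noteq> x3"
    by (auto simp: card_3_iff)
  have "vec.span X = vec.span B" using B(1,3) by (metis subset_antisym vec.span_mono vec.span_minimal vec.subspace_span)
  then have P3: "P = {comb3 x1 x2 x3 A B C | A B C. True}"
    by (simp only: X(1) B3 span_triple)
  have ind: "A = 0 \<and> B = 0 \<and> C = 0" if "comb3 x1 x2 x3 A B C = 0" for A B C
    using independent_triple[OF _ ne that] B(2) B3 by simp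
  have Q: "Q2S S x1" "Q2S S x2" "Q2S S x3" using B(1) B3 X(2) by auto
  have null: "wform x1 x1 = 0" "wform x2 x2 = 0" "wform x3 x3 = 0" using Q by (auto simp: Q2S_def inQ4_def)
  have g12: "wform x1 x2 \<noteq> 0" by (rule null_triple_pairing[OF P3 nondeg ind null])
  have g13: "wform x1 x3 \<noteq> 0"
  proof (rule null_triple_pairing[OF _ nondeg _ null(1,3,2)])
    have e: "comb3 x1 x3 x2 A B C = comb3 x1 x2 x3 A C B" for A B C by (simp add: comb3_def algebra_simps)
    show "P = {comb3 x1 x3 x2 A B C | A B C. True}" unfolding P3 e by blast
    show "A = 0 \<and> B = 0 \<and> C = 0" if "comb3 x1 x3 x2 A B C = 0" for A B C using that ind unfolding e by blast
  qed
  have g23: "wform x2 x3 \<noteq> 0"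
  proof (rule null_triple_pairing[OF _ nondeg _ null(2,3,1)])
    have e: "comb3 x2 x3 x1 A B C = comb3 x1 x2 x3 C A B" for A B C by (simp add: comb3_def algebra_simps)
    show "P = {comb3 x2 x3 x1 A B C | A B C. True}" unfolding P3 e by blast
    show "A = 0 \<and> B = 0 \<and> C = 0" if "comb3 x2 x3 x1 A B C = 0" for A B C using that ind unfolding e by blast
  qed
  obtain p1 q1 where r1: "x1 = ray p1 q1" using Q(1) unfolding Q2S_iff by blast
  obtain p2 q2 where r2: "x2 = ray p2 q2" using Q(2) unfolding Q2S_iff by blast
  obtain p3 q3 where r3: "x3 = ray p3 q3" using Q(3) unfolding Q2S_iff by blast
  have c12: "cross2 p1 p2 \<noteq> 0" "cross2 q1 q2 \<noteq> 0" and c13: "cross2 p1 p3 \<noteq> 0" "cross2 q1 q3 \<noteq> 0"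
    and c23: "cross2 p2 p3 \<noteq> 0" "cross2 q2 q3 \<noteq> 0"
    using g12 g13 g23 unfolding r1 r2 r3 wform_ray by auto
  \<comment> \<open>Cramer coefficients of p3 in p1, p2 and of q3 in q1, q2, nonzero because the
    ends are pairwise distinct.\<close>
  define \<alpha> \<beta> \<gamma> \<delta> where gr: "\<alpha> = - cross2 p2 p3 / cross2 p1 p2" "\<beta> = cross2 p1 p3 / cross2 p1 p2"
    "\<gamma> = - cross2 q2 q3 / cross2 q1 q2" "\<delta> = cross2 q1 q3 / cross2 q1 q2"
  have n: "\<alpha> \<noteq> 0" "\<beta> \<noteq> 0" "\<gamma> \<noteq> 0" "\<delta> \<noteq> 0" using c12 c13 c23 by (simp_all add: gr)
  define P1 P2 Q1 Q2 where PQ: "P1 = (\<alpha> * fst p1, \<alpha> * snd p1)" "P2 = (\<beta> * fst p2, \<beta> * snd p2)"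
    "Q1 = (\<gamma> * fst q1, \<gamma> * snd q1)" "Q2 = (\<delta> * fst q2, \<delta> * snd q2)"
  have cramer: "p = (- cross2 m p / cross2 l m * fst l + cross2 l p / cross2 l m * fst m,
        - cross2 m p / cross2 l m * snd l + cross2 l p / cross2 l m * snd m)"
    if "cross2 l m \<noteq> 0" for p l m :: "complex \<times> complex"
  proof -
    have "- cross2 m p * fst l + cross2 l p * fst m = cross2 l m * fst p"
      "- cross2 m p * snd l + cross2 l p * snd m = cross2 l m * snd p"
      by (simp_all add: cross2_def algebra_simps)
    then show ?thesis using that
      by (simp only: times_divide_eq_left add_divide_distrib[symmetric]) simp
  qed
  have p3: "p3 = (fst P1 + fst P2, snd P1 + snd P2)"
    using cramer[OF c12(1), of p3] unfolding PQ gr by (simp only: fst_conv snd_conv)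
  have q3: "q3 = (fst Q1 + fst Q2, snd Q1 + snd Q2)"
    using cramer[OF c12(2), of q3] unfolding PQ gr by (simp only: fst_conv snd_conv)
  have cr: "cross2 P1 P2 \<noteq> 0" "cross2 Q1 Q2 \<noteq> 0"
  proof -
    have "cross2 P1 P2 = \<alpha> * \<beta> * cross2 p1 p2" "cross2 Q1 Q2 = \<gamma> * \<delta> * cross2 q1 q2"
      by (simp_all add: PQ cross2_def algebra_simps)
    then show "cross2 P1 P2 \<noteq> 0" "cross2 Q1 Q2 \<noteq> 0" using n c12 by auto
  qed
  let ?u1 = "comb a b P1" and ?u2 = "comb a b P2" and ?w1 = "comb c d Q1" and ?w2 = "comb c d Q2"
  interpret N: twistor_pair S ?u1 ?u2 ?w1 ?w2 by (rule basis_change_pair[OF cr])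
  let ?e1 = "wedge ?u1 ?w1" and ?e2 = "wedge ?u2 ?w2" and ?e3 = "wedge ?u1 ?w2 + wedge ?u2 ?w1"
  have e1: "?e1 = (\<alpha> * \<gamma>) *s x1" and e2: "?e2 = (\<beta> * \<delta>) *s x2"
    unfolding r1 r2 ray_def PQ comb_scale[symmetric] wedge_scale by (simp_all add: mult.commute)
  \<comment> \<open>x3 is the conic point with parameter (1, 1), hence the sum of the three frame
    vectors; this determines \<open>?e3\<close>.\<close>
  have "?e1 + ?e2 + ?e3 = wedge (?u1 + ?u2) (?w1 + ?w2)" by (simp add: wedge_add algebra_simps)
  also have "?u1 + ?u2 = comb a b p3" unfolding p3 by (simp add: comb_def vec_eq_iff algebra_simps)
  also have "?w1 + ?w2 = comb c d q3" unfolding q3 by (simp add: comb_def vec_eq_iff algebra_simps)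
  finally have e3: "?e3 = x3 - (\<alpha> * \<gamma>) *s x1 - (\<beta> * \<delta>) *s x2"
    unfolding r3 ray_def[of p3 q3] e1 e2 by (simp add: algebra_simps)
  have ce: "comb3 ?e1 ?e2 ?e3 A B C = comb3 x1 x2 x3 (\<alpha> * \<gamma> * (A - C)) (\<beta> * \<delta> * (B - C)) C" for A B C
    unfolding e1 e2 e3 by (simp add: comb3_def vec_eq_iff algebra_simps)
  have "P = {comb3 ?e1 ?e2 ?e3 A B C | A B C. True}"
  proof (intro equalityI subsetI)
    fix x assume "x \<in> P"
    then obtain A B C where x: "x = comb3 x1 x2 x3 A B C" using P3 by blast
    have "x = comb3 ?e1 ?e2 ?e3 (A / (\<alpha> * \<gamma>) + C) (B / (\<beta> * \<delta>) + C) C"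
      unfolding ce x using n by simp
    then show "x \<in> {comb3 ?e1 ?e2 ?e3 A B C | A B C. True}" by blast
  next
    fix x assume "x \<in> {comb3 ?e1 ?e2 ?e3 A B C | A B C. True}"
    then show "x \<in> P" unfolding ce P3 by blast
  qed
  then have "conic_frame P ?e1 ?e2 ?e3"
    unfolding conic_frame_def using N.K_nonzero
    by (simp add: N.pairings wform_bilinear wform_wedge_repeat)
  then have "twistor_conic S ?u1 ?u2 ?w1 ?w2 P" using plane by unfold_locales
  then show ?thesis by blast
qed

end

section \<open>The two twistor lifts of a sphere\<close>

lemma jmap_antilinear: "jmap (x + y) = jmap x + jmap y" "jmap (k *s x) = cnj k *s jmap x"
  by (simp_all add: vec_eq_iff forall_4 jmap_nth)

lemma jmap_jmap: "jmap (jmap v) = - v"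
  by (simp add: vec_eq_iff forall_4 jmap_nth)

lemma jmap_zero: "jmap 0 = 0"
  by (simp add: vec_eq_iff forall_4 jmap_nth)

lemma subspace_jmap:
  assumes "vec.subspace V"
  shows "vec.subspace (jmap ` V)"
proof (rule vec.subspaceI)
  show "0 \<in> jmap ` V" using jmap_zero vec.subspace_0[OF assms] by (metis imageI)
next
  fix x y assume "x \<in> jmap ` V" "y \<in> jmap ` V"
  then show "x + y \<in> jmap ` V"
    using vec.subspace_add[OF assms] jmap_antilinear(1) by (auto simp: image_iff) metis
next
  fix c x assume "x \<in> jmap ` V"
  then obtain v where v: "v \<in> V" "x = jmap v" by blast
  then have "c *s x = jmap (cnj c *s v)" by (simp add: jmap_antilinear)
  then show "c *s x \<in> jmap ` V" using vec.subspace_scale[OF assms] v by blast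
qed

lemma dim_jmap_le:
  assumes "vec.subspace V"
  shows "vec.dim (jmap ` V) \<le> vec.dim V"
proof -
  obtain B where B: "B \<subseteq> V" "vec.independent B" "V \<subseteq> vec.span B" "card B = vec.dim V"
    using vec.basis_exists by blast
  have fin: "finite B" using B(2) by (rule vec.finiteI_independent)
  have "jmap v \<in> vec.span (jmap ` B)" if "v \<in> vec.span B" for v
    using that
  proof (induction rule: vec.span_induct_alt)
    case base
    then show ?case by (simp add: jmap_zero vec.span_zero)
  next
    case (step c x y)
    then show ?case
      using vec.span_add[OF vec.span_scale[OF vec.span_base[OF imageI]]]
      by (simp add: jmap_antilinear)
  qed
  then have "jmap ` V \<subseteq> vec.span (jmap ` B)" using B(3) by blast
  then have "vec.dim (jmap ` V) \<le> card (jmap ` B)" using fin by (intro vec.dim_le_card) auto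
  also have "\<dots> \<le> card B" using fin by (rule card_image_le)
  finally show ?thesis using B(4) by simp
qed

lemma dim_jmap:
  assumes "vec.subspace V"
  shows "vec.dim (jmap ` V) = vec.dim V"
proof (rule antisym[OF dim_jmap_le[OF assms]])
  have "jmap ` (jmap ` V) = V"
  proof (intro equalityI subsetI)
    fix x assume "x \<in> jmap ` (jmap ` V)"
    then show "x \<in> V" using vec.subspace_neg[OF assms] by (auto simp: jmap_jmap)
  next
    fix x assume "x \<in> V"
    then have "- x \<in> V" using vec.subspace_neg[OF assms] by blast
    then show "x \<in> jmap ` (jmap ` V)" using jmap_jmap[of "- x"] by (metis imageI minus_minus)
  qed
  then show "vec.dim V \<le> vec.dim (jmap ` V)"
    using dim_jmap_le[OF subspace_jmap[OF assms]] by simp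
qed

lemma matrix_vector_mult_uminus: "(- A) *v x = - (A *v (x :: complex^'n))"
  by (simp add: matrix_vector_mult_def vec_eq_iff sum_negf)

text \<open>The eigenspaces of S for i and -i span C^4. As j commutes with S but conjugates scalars,
  it maps one onto the other, so both have dimension 2.\<close>

lemma twistor_pair_exists:
  fixes S :: "complex^4^4"
  assumes H: "H_linear S" and S2: "S ** S = - mat 1"
  shows "\<exists>a b c d. twistor_pair S a b c d"
proof -
  let ?L = "twistor_lift S" and ?M = "jmap ` twistor_lift S"
  have SS: "S *v (S *v v) = - v" for v
    by (simp add: matrix_vector_mul_assoc S2 matrix_vector_mult_uminus)
  have L: "vec.subspace ?L"
    by (rule vec.subspaceI)
       (auto simp: twistor_lift_def matrix_vector_right_distrib vector_scalar_commute
          vector_add_ldistrib mult.commute)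
  have M: "vec.subspace ?M" by (rule subspace_jmap[OF L])
  have M_eq: "?M = {w. S *v w = (- \<i>) *s w}"
  proof (intro equalityI subsetI)
    fix w assume "w \<in> ?M"
    then show "w \<in> {w. S *v w = (- \<i>) *s w}"
      using H by (auto simp: twistor_lift_def H_linear_def jmap_antilinear)
  next
    fix w assume "w \<in> {w. S *v w = (- \<i>) *s w}"
    then have w: "S *v w = (- \<i>) *s w" by simp
    have "S *v jmap w = \<i> *s jmap w" using H w jmap_antilinear(2)[of "- \<i>" w] by (simp add: H_linear_def)
    then have "- jmap w \<in> ?L" using vec.subspace_neg[OF L] by (auto simp: twistor_lift_def)
    moreover have "w = jmap (- jmap w)"
      using jmap_antilinear(2)[of "-1" "jmap w"] by (simp add: jmap_jmap)
    ultimately show "w \<in> ?M" by blast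
  qed
  have sum: "\<exists>x y. x \<in> ?L \<and> y \<in> ?M \<and> v = x + y" for v
  proof (intro exI conjI)
    \<comment> \<open>The spectral projections (1 - iS)/2 and (1 + iS)/2.\<close>
    let ?x = "(1/2) *s (v - \<i> *s (S *v v))" and ?y = "(1/2) *s (v + \<i> *s (S *v v))"
    show "?x \<in> ?L"
      by (simp add: twistor_lift_def vector_scalar_commute matrix_vector_mult_diff_distrib SS
            vec_eq_iff algebra_simps)
    show "?y \<in> ?M"
      by (simp add: M_eq vector_scalar_commute matrix_vector_right_distrib SS
            vec_eq_iff algebra_simps)
    show "v = ?x + ?y" by (simp add: vec_eq_iff algebra_simps)
  qed
  have int: "?L \<inter> ?M = {0}"
  proof (intro equalityI subsetI)
    fix v assume "v \<in> ?L \<inter> ?M"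
    then have "v \<in> ?L" "v \<in> {w. S *v w = (- \<i>) *s w}" unfolding M_eq[symmetric] by blast+
    then have "S *v v = \<i> *s v" "S *v v = (- \<i>) *s v"
      unfolding twistor_lift_def mem_Collect_eq by blast+
    then have "\<i> *s v = (- \<i>) *s v" by (rule subst)
    then have e: "\<i> * v $ j = - \<i> * v $ j" for j by (metis vector_smult_component)
    have "v $ j = 0" for j using e[of j] by simp
    then show "v \<in> {0}" by (simp add: vec_eq_iff)
  qed (use L M vec.subspace_0 in blast)
  have "vec.dim {x + y | x y. x \<in> ?L \<and> y \<in> ?M} + vec.dim (?L \<inter> ?M) = vec.dim ?L + vec.dim ?M"
    by (rule vec.dim_sums_Int[OF L M])
  moreover have "vec.dim {x + y | x y. x \<in> ?L \<and> y \<in> ?M} = vec.dim (UNIV :: c4 set)"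
    using sum by (intro arg_cong[where f = vec.dim]) blast
  moreover have "vec.dim {0::c4} = 0" by simp
  moreover have "vec.dim (UNIV :: c4 set) = 4" unfolding vec_dim_card by simp
  ultimately have "vec.dim ?L + vec.dim ?M = 4" unfolding int by linarith
  then have "vec.dim ?L = 2" "vec.dim ?M = 2" using dim_jmap[OF L] by simp_all
  then obtain a b c d where bas: "cbasis2 ?L a b" "cbasis2 ?M c d"
    using cbasis2_exists[OF L] cbasis2_exists[OF M] by blast
  have "\<exists>p q. v = comb a b p + comb c d q" for v
  proof -
    obtain x y where xy: "x \<in> ?L" "y \<in> ?M" "v = x + y" using sum[of v] by blast
    obtain p where "x = comb a b p" using xy(1) unfolding cbasis2_eq_range[OF bas(1)] by (rule imageE)
    moreover obtain q where "y = comb c d q" using xy(2) unfolding cbasis2_eq_range[OF bas(2)] by (rule imageE)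
    ultimately show ?thesis using xy(3) by (intro exI[of _ p] exI[of _ q]) simp
  qed
  then have "twistor_pair S a b c d" using bas by unfold_locales
  then show ?thesis by blast
qed

section \<open>Faces and their far corners\<close>

text \<open>One step towards 0 from either side, with \<open>near 0 = 0\<close>. The other vertices
  of the face with far corner (k, l) use \<open>near k\<close> and \<open>near l\<close>.\<close>

definition near :: "int \<Rightarrow> int" where
  "near k = k - sgn k"

lemma nat_abs_near: "k \<noteq> 0 \<Longrightarrow> nat \<bar>near k\<bar> < nat \<bar>k\<bar>"
  by (auto simp: near_def sgn_if)

lemma far_corner_surj:
  assumes "k \<noteq> 0" "l \<noteq> 0"
  shows "\<exists>m n. far_corner m n = (k, l)"
  using assms
  \<comment> \<open>A face is indexed by its smallest coordinates, so the far corner is at m + 1 on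
    the nonnegative side but at m on the negative side.\<close>
  by (intro exI[of _ "if k > 0 then k - 1 else k"] exI[of _ "if l > 0 then l - 1 else l"])
     (auto simp: far_corner_def)

lemma far_corner_cases:
  assumes "far_corner m n = (k, l)"
  shows "k \<noteq> 0" "l \<noteq> 0"
    and "(k = m + 1 \<and> near k = m \<or> k = m \<and> near k = m + 1) \<and>
      (l = n + 1 \<and> near l = n \<or> l = n \<and> near l = n + 1)"
  using assms by (auto simp: far_corner_def near_def sgn_if split: if_splits)

lemma face_vertices:
  assumes "far_corner m n = (k, l)"
  shows "{\<phi> (m+1) n, \<phi> m n, \<phi> m (n+1), \<phi> (m+1) (n+1)}
    = {\<phi> k l, \<phi> (near k) l, \<phi> (near k) (near l), \<phi> k (near l)}"
  using far_corner_cases(3)[OF assms] by auto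

lemma known_plane_eq:
  assumes "far_corner m n = (k, l)"
  shows "known_plane \<phi> m n = vec.span {\<phi> (near k) l, \<phi> (near k) (near l), \<phi> k (near l)}"
proof -
  have "{(m+1,n), (m,n), (m,n+1), (m+1,n+1)} - {far_corner m n}
    = {(near k, l), (near k, near l), (k, near l)}"
    unfolding assms using far_corner_cases(3)[OF assms] by auto
  then show ?thesis by (simp add: known_plane_def)
qed

lemma face_plane_eq:
  assumes "far_corner m n = (k, l)"
  shows "face_plane \<phi> m n = vec.span {\<phi> k l, \<phi> (near k) l, \<phi> (near k) (near l), \<phi> k (near l)}"
  unfolding face_plane_def face_vertices[OF assms] ..

text \<open>By the Klein four-group invariance of the cross-ratio, the face may be read off
from its far corner in the same way in all four quadrants.\<close>

lemma face_function_eq: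
  assumes fc: "far_corner m n = (k, l)"
    and F: "\<And>x y z w. x \<in> A \<Longrightarrow> y \<in> A \<Longrightarrow> z \<in> A \<Longrightarrow> w \<in> A \<Longrightarrow> F x y z w = F y x w z \<and> F x y z w = F z w x y"
    and A: "\<And>i j. \<phi> i j \<in> A"
  shows "F (\<phi> (m+1) n) (\<phi> m n) (\<phi> m (n+1)) (\<phi> (m+1) (n+1))
    = F (\<phi> k (near l)) (\<phi> (near k) (near l)) (\<phi> (near k) l) (\<phi> k l)"
proof -
  define v1 v2 v3 v4 where v: "v1 = \<phi> (m+1) n" "v2 = \<phi> m n" "v3 = \<phi> m (n+1)" "v4 = \<phi> (m+1) (n+1)"
  have mem: "v1 \<in> A" "v2 \<in> A" "v3 \<in> A" "v4 \<in> A" unfolding v by (rule A)+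
  have S: "F v1 v2 v3 v4 = F v2 v1 v4 v3" "F v1 v2 v3 v4 = F v3 v4 v1 v2" "F v2 v1 v4 v3 = F v4 v3 v2 v1"
    using F[OF mem] F[OF mem(2,1,4,3)] by blast+
  consider "k = m + 1" "near k = m" "l = n + 1" "near l = n" | "k = m + 1" "near k = m" "l = n" "near l = n + 1"
    | "k = m" "near k = m + 1" "l = n + 1" "near l = n" | "k = m" "near k = m + 1" "l = n" "near l = n + 1"
    using far_corner_cases(3)[OF fc] by blast
  then show ?thesis
    unfolding v[symmetric]
    by cases (use S in \<open>simp_all add: v\<close>)
qed

text \<open>The filling rule \<open>h\<close> stays abstract here, so that it can later be a choice
  of conic points. At the origin the first axis takes precedence.\<close>

function net :: "(int \<Rightarrow> 'a) \<Rightarrow> (int \<Rightarrow> 'a) \<Rightarrow> ('a \<Rightarrow> 'a \<Rightarrow> 'a \<Rightarrow> 'a) \<Rightarrow> int \<Rightarrow> int \<Rightarrow> 'a" where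
  "net f g h k l = (if l = 0 then f k else if k = 0 then g l
     else h (net f g h (near k) l) (net f g h (near k) (near l)) (net f g h k (near l)))"
  by pat_completeness auto
termination
  by (relation "Wellfounded.measure (\<lambda>(f, g, h, k, l). nat \<bar>k\<bar> + nat \<bar>l\<bar>)")
     (auto simp: near_def sgn_if)

declare net.simps [simp del]

lemma net_induct [case_names axis1 axis2 far]:
  assumes "\<And>k. P k 0" "\<And>l. P 0 l"
    and "\<And>k l. k \<noteq> 0 \<Longrightarrow> l \<noteq> 0 \<Longrightarrow> P (near k) l \<Longrightarrow> P (near k) (near l) \<Longrightarrow> P k (near l) \<Longrightarrow> P k l"
  shows "P k l"
proof (induction "nat \<bar>k\<bar> + nat \<bar>l\<bar>" arbitrary: k l rule: less_induct)
  case less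
  show ?case
  proof (cases "k = 0 \<or> l = 0")
    case True
    then show ?thesis using assms(1,2) by blast
  next
    case False
    then have "k \<noteq> 0" "l \<noteq> 0" by auto
    note n = nat_abs_near[OF \<open>k \<noteq> 0\<close>] nat_abs_near[OF \<open>l \<noteq> 0\<close>]
    have "P (near k) l" "P (near k) (near l)" "P k (near l)"
      by (rule less; use n in linarith)+
    then show ?thesis using assms(3) \<open>k \<noteq> 0\<close> \<open>l \<noteq> 0\<close> by blast
  qed
qed

section \<open>Conic nets and cross-ratio nets\<close>

lemma ppar_reducible:
  assumes "ppar x y"
  shows "\<not> irreducible_conic_plane (vec.span {x, y, z})"
proof
  assume irr: "irreducible_conic_plane (vec.span {x, y, z})"
  obtain k where "x = k *s y" using assms by (auto simp: ppar_def)
  then have "x \<in> vec.span {y, z}" by (simp add: vec.span_scale vec.span_base)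
  then have "{x, y, z} \<subseteq> vec.span {y, z}" by (auto simp: vec.span_base)
  then have "vec.span {x, y, z} \<subseteq> vec.span {y, z}" by (rule vec.span_minimal) simp
  then have "vec.dim (vec.span {x, y, z}) \<le> card {y, z}" by (rule vec.dim_le_card) simp
  moreover have "card {y, z} \<le> 2" by (simp add: card_insert_if)
  ultimately show False using irr by (simp add: irreducible_conic_plane_def)
qed

lemma real_pt_ppar: "ppar u v \<Longrightarrow> real_pt v \<noteq> 0 \<Longrightarrow> ppar (real_pt u) (real_pt v)"
proof -
  assume uv: "ppar u v" and n: "real_pt v \<noteq> 0"
  then obtain c where c: "u = c *s v" "c \<noteq> 0" by (auto simp: ppar_def)
  have "real_pt u = (c * cnj c) *s real_pt v"
    by (simp add: c real_pt_def jmap_antilinear wedge_scale)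
  then show ?thesis using n c by (simp add: ppar_scale)
qed

lemma span_ppar:
  assumes "ppar x x'" "ppar y y'" "ppar z z'"
  shows "vec.span {x, y, z} = vec.span {x', y', z'}"
proof -
  have *: "vec.span {x, y, z} \<subseteq> vec.span {x', y', z'}"
    if h: "ppar x x'" "ppar y y'" "ppar z z'" for x y z x' y' z' :: "'a::field^'n"
  proof (rule vec.span_minimal)
    obtain i j k where "x = i *s x'" "y = j *s y'" "z = k *s z'" using h unfolding ppar_def by blast
    then show "{x, y, z} \<subseteq> vec.span {x', y', z'}" by (simp add: vec.span_scale vec.span_base)
  qed simp
  show ?thesis using *[OF assms] *[OF assms[THEN ppar_sym]] by (rule subset_antisym)
qed

context twistor_pair
begin

lemma line_basis_lift: "line_basis (twistor_lift S)"
  using ab by (auto simp: line_basis_def)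

context
  fixes P X
  assumes P: "irreducible_conic_plane P" "P = vec.span X" "\<And>x. x \<in> X \<Longrightarrow> Q2S S x"
begin

lemma steiner_eq_cr_plane:
  assumes "Q2S S x1" "Q2S S x2" "Q2S S x3" "Q2S S x4" "x1 \<in> P" "x2 \<in> P" "x3 \<in> P" "x4 \<in> P"
  shows "steiner_cr P x1 x2 x3 x4
    = cr_on (twistor_lift S) (piS S x1) (piS S x2) (piS S x3) (piS S x4)"
proof -
  obtain u1 u2 w1 w2 where "twistor_conic S u1 u2 w1 w2 P"
    using irreducible_plane_is_twistor_conic[OF P] by blast
  then show ?thesis using assms by (rule twistor_conic.steiner_eq_cr)
qed

lemma piS_inj_plane:
  assumes "Q2S S x" "Q2S S y" "x \<in> P" "y \<in> P" "ppar (piS S x) (piS S y)"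
  shows "ppar x y"
proof -
  obtain u1 u2 w1 w2 where "twistor_conic S u1 u2 w1 w2 P"
    using irreducible_plane_is_twistor_conic[OF P] by blast
  then show ?thesis using assms by (rule twistor_conic.piS_inj)
qed

lemma piS_onto_plane:
  assumes "v \<in> twistor_lift S" "v \<noteq> 0"
  shows "\<exists>x\<in>P. Q2S S x \<and> ppar (piS S x) v"
proof -
  obtain u1 u2 w1 w2 where "twistor_conic S u1 u2 w1 w2 P"
    using irreducible_plane_is_twistor_conic[OF P] by blast
  then show ?thesis using assms by (rule twistor_conic.piS_onto)
qed

end

text \<open>Points of one conic with the same image coincide, which would drop the dimension of the
  plane. This supplies the distinctness needed to solve for the fourth point of a
  cross-ratio.\<close>

lemma piS_pairwise_distinct:
  assumes Q: "Q2S S x" "Q2S S y" "Q2S S z" and P: "irreducible_conic_plane (vec.span {x, y, z})"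
  shows "\<not> ppar (piS S z) (piS S y)" "\<not> ppar (piS S y) (piS S x)" "\<not> ppar (piS S z) (piS S x)"
proof -
  have X: "\<And>t. t \<in> {x, y, z} \<Longrightarrow> Q2S S t" using Q by blast
  have m: "x \<in> vec.span {x, y, z}" "y \<in> vec.span {x, y, z}" "z \<in> vec.span {x, y, z}"
    by (simp_all add: vec.span_base)
  note inj = piS_inj_plane[OF P refl X]
  have n: "\<not> ppar z y" "\<not> ppar y x" "\<not> ppar z x"
    using ppar_reducible[of z y x] ppar_reducible[of y x z] ppar_reducible[of z x y] P
    by (auto simp: insert_commute)
  show "\<not> ppar (piS S z) (piS S y)" using inj[OF _ Q(3,2) m(3,2)] n(1) by blast
  show "\<not> ppar (piS S y) (piS S x)" using inj[OF _ Q(2,1) m(2,1)] n(2) by blast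
  show "\<not> ppar (piS S z) (piS S x)" using inj[OF _ Q(3,1) m(3,1)] n(3) by blast
qed

text \<open>Irreducibility is asked of a single face, so the lemma gives part (a) and is also
  available while the net of part (b) is being examined.\<close>

lemma face_steiner_eq_cr:
  assumes Q: "\<And>k l. Q2S S (\<phi> k l)" and irr: "irreducible_conic_plane (face_plane \<phi> m n)"
  shows "face_steiner \<phi> m n = face_cr (twistor_lift S) (\<lambda>k l. piS S (\<phi> k l)) m n"
proof -
  have m: "\<phi> (m+1) n \<in> face_plane \<phi> m n" "\<phi> m n \<in> face_plane \<phi> m n"
    "\<phi> m (n+1) \<in> face_plane \<phi> m n" "\<phi> (m+1) (n+1) \<in> face_plane \<phi> m n"
    by (simp_all add: face_plane_def vec.span_base)
  show ?thesis unfolding face_steiner_def face_cr_def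
    by (rule steiner_eq_cr_plane[OF irr face_plane_def _ Q Q Q Q m]) (use Q in auto)
qed

lemma face_cr_far_corner:
  assumes fc: "far_corner m n = (k, l)" and psi: "\<And>k l. \<psi> k l \<in> twistor_lift S"
  shows "face_cr (twistor_lift S) \<psi> m n
    = cr_on (twistor_lift S) (\<psi> k (near l)) (\<psi> (near k) (near l)) (\<psi> (near k) l) (\<psi> k l)"
  unfolding face_cr_def
  by (rule face_function_eq[OF fc _ psi]) (use cr_on_klein[OF line_basis_lift] in blast)

text \<open>Any point of Q^2_S is allowed when the plane is not irreducible, so the recursion is
  total before irreducibility is known. The order z, y, x, w is the reading of a face whose far
  corner is w.\<close>

definition next_vertex :: "complex \<Rightarrow> bv \<Rightarrow> bv \<Rightarrow> bv \<Rightarrow> bv" where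
  "next_vertex lam x y z = (SOME w. Q2S S w \<and> (irreducible_conic_plane (vec.span {x, y, z}) \<longrightarrow>
      w \<in> vec.span {x, y, z} \<and> steiner_cr (vec.span {x, y, z}) z y x w = lam))"

text \<open>The fourth point is found on the lift by \<open>cr_on_exists\<close> and carried back to
  the conic by \<open>piS_onto_plane\<close>.\<close>

lemma next_vertex:
  assumes Q: "Q2S S x" "Q2S S y" "Q2S S z"
  shows "Q2S S (next_vertex lam x y z) \<and> (irreducible_conic_plane (vec.span {x, y, z}) \<longrightarrow>
      next_vertex lam x y z \<in> vec.span {x, y, z} \<and>
      steiner_cr (vec.span {x, y, z}) z y x (next_vertex lam x y z) = lam)"
  unfolding next_vertex_def
proof (rule someI_ex, cases "irreducible_conic_plane (vec.span {x, y, z})")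
  case False
  then show "\<exists>w. Q2S S w \<and> (irreducible_conic_plane (vec.span {x, y, z}) \<longrightarrow>
      w \<in> vec.span {x, y, z} \<and> steiner_cr (vec.span {x, y, z}) z y x w = lam)"
    using Q by blast
next
  case True
  let ?P = "vec.span {x, y, z}" and ?L = "twistor_lift S"
  have X: "\<And>t. t \<in> {x, y, z} \<Longrightarrow> Q2S S t" using Q by blast
  have m: "x \<in> ?P" "y \<in> ?P" "z \<in> ?P" by (simp_all add: vec.span_base)
  obtain v where v: "v \<in> ?L" "v \<noteq> 0" "cr_on ?L (piS S z) (piS S y) (piS S x) v = lam"
    using cr_on_exists[OF line_basis_lift piS_mem(1)[OF Q(3)] piS_mem(1)[OF Q(2)] piS_mem(1)[OF Q(1)]
      piS_mem(2)[OF Q(3)] piS_mem(2)[OF Q(2)] piS_mem(2)[OF Q(1)] piS_pairwise_distinct[OF Q True]]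
    by blast
  obtain w where w: "w \<in> ?P" "Q2S S w" "ppar (piS S w) v"
    using piS_onto_plane[OF True refl X v(1,2)] by blast
  have "steiner_cr ?P z y x w = cr_on ?L (piS S z) (piS S y) (piS S x) (piS S w)"
    by (rule steiner_eq_cr_plane[OF True refl X Q(3,2,1) w(2) m(3,2,1) w(1)])
  also have "\<dots> = cr_on ?L (piS S z) (piS S y) (piS S x) v"
    by (rule cr_on_ppar[OF line_basis_lift]) (use piS_mem Q v w ppar_refl in auto)
  finally show "\<exists>w. Q2S S w \<and> (irreducible_conic_plane ?P \<longrightarrow>
      w \<in> ?P \<and> steiner_cr ?P z y x w = lam)"
    using w v by blast
qed

text \<open>Comparing \<open>piS S (\<phi> k n)\<close> with \<open>\<psi>\<close>, and two nets
  with each other, are both inductions from the axes resting on uniqueness of the fourth point on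
  the lift; injectivity of \<open>piS\<close> on a conic carries the second comparison back to the
  net.\<close>

lemma cross_ratio_evolution:
  fixes p :: "int \<Rightarrow> c4" and lam :: complex and \<psi> :: "int \<Rightarrow> int \<Rightarrow> c4"
  assumes p: "\<And>k. p k \<noteq> 0" "\<And>k. p k \<in> twistor_lift S"
    and psi: "\<And>k n. \<psi> k n \<noteq> 0" "\<And>k n. \<psi> k n \<in> twistor_lift S"
    and psi_p: "\<And>k. ppar (\<psi> k 0) (p k)"
    and psi_cr: "\<And>k n. face_cr (twistor_lift S) \<psi> k n = lam"
    and ci: "construction_irreducible S p \<psi> lam"
  shows "\<exists>\<phi>. (\<forall>k n. Q2S S (\<phi> k n)) \<and> conic_net_Q4 \<phi> \<and> boundary_ok p \<psi> \<phi> \<and>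
              (\<forall>m n. face_steiner \<phi> m n = lam) \<and>
              (\<forall>\<phi>'. (\<forall>k n. Q2S S (\<phi>' k n)) \<and> conic_net_Q4 \<phi>' \<and> boundary_ok p \<psi> \<phi>' \<and>
                     (\<forall>m n. face_steiner \<phi>' m n = lam) \<longrightarrow> (\<forall>k n. ppar (\<phi>' k n) (\<phi> k n))) \<and>
              (\<forall>k n. ppar (piS S (\<phi> k n)) (\<psi> k n))"
proof -
  let ?L = "twistor_lift S"
  define \<phi> where "\<phi> = net (\<lambda>k. real_pt (p k)) (\<lambda>n. real_pt (\<psi> 0 n)) (next_vertex lam)"
  have ax1: "\<phi> k 0 = real_pt (p k)" for k by (simp add: \<phi>_def net.simps)
  have ax2: "\<phi> 0 n = real_pt (\<psi> 0 n)" if "n \<noteq> 0" for n using that by (simp add: \<phi>_def net.simps)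
  have phi_far: "\<phi> k l = next_vertex lam (\<phi> (near k) l) (\<phi> (near k) (near l)) (\<phi> k (near l))"
    if "k \<noteq> 0" "l \<noteq> 0" for k l
    unfolding \<phi>_def using that by (subst net.simps) simp
  have Qr: "Q2S S (real_pt (p k))" "Q2S S (real_pt (\<psi> k n))" for k n
    using real_pt_Q2S(1) p psi by blast+
  have Q: "Q2S S (\<phi> k l)" for k l
  proof (induction k l rule: net_induct)
    case (axis1 k)
    then show ?case by (simp add: ax1 Qr)
  next
    case (axis2 l)
    then show ?case by (cases "l = 0") (simp_all add: ax1 ax2 Qr)
  next
    case (far k l)
    then show ?case using phi_far[OF far(1,2)] next_vertex by simp
  qed
  have nz: "x \<noteq> 0" if "Q2S S x" for x using that by (simp add: Q2S_def inQ4_def)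
  have bd: "boundary_ok p \<psi> \<phi>"
    unfolding boundary_ok_def
  proof (intro conjI allI)
    show "ppar (\<phi> k 0) (real_pt (p k))" for k unfolding ax1 using nz Qr ppar_refl by blast
    show "ppar (\<phi> 0 n) (real_pt (\<psi> 0 n))" for n
    proof (cases "n = 0")
      \<comment> \<open>At the origin the axes prescribe \<open>p 0\<close> and
        \<open>\<psi> 0 0\<close>, which agree only up to a scalar.\<close>
      case True
      then show ?thesis using real_pt_ppar[OF ppar_sym[OF psi_p]] psi nz Qr by (simp add: ax1)
    qed (use ax2 nz Qr ppar_refl in metis)
  qed
  let ?Z = "\<lambda>\<phi> k l. \<phi> k (near l)" and ?Y = "\<lambda>\<phi> k l. \<phi> (near k) (near l)" and ?X = "\<lambda>\<phi> k l. \<phi> (near k) l"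
  let ?P = "\<lambda>\<phi> k l. vec.span {?X \<phi> k l, ?Y \<phi> k l, ?Z \<phi> k l}"
  have step: "\<phi> k l \<in> known_plane \<phi> m n \<and> face_plane \<phi> m n = known_plane \<phi> m n \<and>
      face_steiner \<phi> m n = lam"
    if fc: "far_corner m n = (k, l)" and irr: "irreducible_conic_plane (known_plane \<phi> m n)" for m n k l
  proof -
    have kp: "known_plane \<phi> m n = ?P \<phi> k l" by (rule known_plane_eq[OF fc])
    have X: "\<And>t. t \<in> {?X \<phi> k l, ?Y \<phi> k l, ?Z \<phi> k l} \<Longrightarrow> Q2S S t" using Q by blast
    have nv: "\<phi> k l \<in> ?P \<phi> k l" "steiner_cr (?P \<phi> k l) (?Z \<phi> k l) (?Y \<phi> k l) (?X \<phi> k l) (\<phi> k l) = lam"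
      using next_vertex[OF Q Q Q, of lam "near k" l "near k" "near l" k "near l"] irr
        phi_far[OF far_corner_cases(1,2)[OF fc]] unfolding kp by simp_all
    have fp: "face_plane \<phi> m n = known_plane \<phi> m n"
      unfolding face_plane_eq[OF fc] kp using nv(1) by (rule vec.span_redundant)
    have m: "?X \<phi> k l \<in> ?P \<phi> k l" "?Y \<phi> k l \<in> ?P \<phi> k l" "?Z \<phi> k l \<in> ?P \<phi> k l"
      by (simp_all add: vec.span_base)
    have "face_steiner \<phi> m n = cr_on ?L (piS S (?Z \<phi> k l)) (piS S (?Y \<phi> k l)) (piS S (?X \<phi> k l)) (piS S (\<phi> k l))"
      using face_steiner_eq_cr[OF Q] irr fp face_cr_far_corner[OF fc, of "\<lambda>k l. piS S (\<phi> k l)", OF piS_mem(1)[OF Q]] by simp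
    also have "\<dots> = lam"
      using steiner_eq_cr_plane[OF irr[unfolded kp] refl X Q Q Q Q m(3,2,1) nv(1)] nv(2) by simp
    finally show ?thesis using nv(1) fp kp by simp
  qed
  have st: "steiner_cr (known_plane \<phi> m n) (\<phi> (m+1) n) (\<phi> m n) (\<phi> m (n+1)) (\<phi> (m+1) (n+1)) = lam"
    if "irreducible_conic_plane (known_plane \<phi> m n)" for m n
  proof -
    obtain k l where "far_corner m n = (k, l)" by (meson surj_pair)
    from step[OF this that] have "face_plane \<phi> m n = known_plane \<phi> m n" "face_steiner \<phi> m n = lam"
      by blast+
    then show ?thesis unfolding face_steiner_def by (rule subst)
  qed
  \<comment> \<open>The net obeys the evolution rule wherever the known plane is irreducible.
    Besides membership in Q^2_S and the boundary values, this is all that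
    \<open>construction_irreducible\<close> asks, so its conclusion covers every face.\<close>
  have irr: "irreducible_conic_plane (known_plane \<phi> m n)" for m n
  proof -
    have "(\<forall>m n. irreducible_conic_plane (known_plane \<phi> m n) \<longrightarrow>
                 (case far_corner m n of (k,l) \<Rightarrow> \<phi> k l \<in> known_plane \<phi> m n) \<and>
                 steiner_cr (known_plane \<phi> m n)
                    (\<phi> (m+1) n) (\<phi> m n) (\<phi> m (n+1)) (\<phi> (m+1) (n+1)) = lam)"
      using st step by (auto split: prod.split)
    then show ?thesis using ci Q bd unfolding construction_irreducible_def by blast
  qed
  have irrf: "irreducible_conic_plane (face_plane \<phi> m n)" and fs: "face_steiner \<phi> m n = lam" for m n
    
  proof -
    obtain k l where "far_corner m n = (k, l)" by (meson surj_pair)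
    from step[OF this irr] irr[of m n] show "irreducible_conic_plane (face_plane \<phi> m n)" "face_steiner \<phi> m n = lam"
      by simp_all
  qed
  have cn: "conic_net_Q4 \<phi>"
    unfolding conic_net_Q4_def conjugate_net_def
  proof (intro conjI allI)
    fix m n
    show "vec.dim (vec.span {\<phi> (m+1) n, \<phi> m n, \<phi> m (n+1), \<phi> (m+1) (n+1)}) \<le> 3"
      using irrf[of m n] by (simp add: irreducible_conic_plane_def face_plane_def)
  qed (use Q nz irrf Q2S_def in auto)
  have irrP: "irreducible_conic_plane (?P \<phi> k l)" if "k \<noteq> 0" "l \<noteq> 0" for k l
    using far_corner_surj[OF that] irr known_plane_eq by metis
  have crW: "cr_on ?L (piS S (?Z \<phi> k l)) (piS S (?Y \<phi> k l)) (piS S (?X \<phi> k l)) (piS S (\<phi> k l)) = lam"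
    if kl: "k \<noteq> 0" "l \<noteq> 0" for k l
  proof -
    obtain m n where fc: "far_corner m n = (k, l)" using far_corner_surj[OF kl] by blast
    show ?thesis using face_steiner_eq_cr[OF Q irrf[of m n]] fs[of m n] face_cr_far_corner[OF fc, of "\<lambda>k l. piS S (\<phi> k l)", OF piS_mem(1)[OF Q]]
      by simp
  qed
  have inP: "\<phi> k l \<in> ?P \<phi> k l" if kl: "k \<noteq> 0" "l \<noteq> 0" for k l
  proof -
    obtain m n where fc: "far_corner m n = (k, l)" using far_corner_surj[OF kl] by blast
    show ?thesis using step[OF fc irr] known_plane_eq[OF fc] by simp
  qed
  have mem: "?X \<phi> k l \<in> ?P \<phi> k l" "?Y \<phi> k l \<in> ?P \<phi> k l" "?Z \<phi> k l \<in> ?P \<phi> k l" for k l and \<phi> :: "int \<Rightarrow> int \<Rightarrow> bv"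
    by (simp_all add: vec.span_base)
  have lam: "lam \<noteq> 0"
  proof
    assume 0: "lam = 0"
    have near: "near 1 = 0" "near 2 = 1" by (simp_all add: near_def)
    have Pd: "irreducible_conic_plane (vec.span {\<phi> 0 1, \<phi> 0 0, \<phi> 1 0})"
      using irrP[of 1 1] by (simp add: near)
    have c0: "cr_on ?L (piS S (\<phi> 1 0)) (piS S (\<phi> 0 0)) (piS S (\<phi> 0 1)) (piS S (\<phi> 1 1)) = 0"
      using crW[of 1 1] 0 by (simp add: near)
    have in11: "\<phi> 1 1 \<in> vec.span {\<phi> 0 1, \<phi> 0 0, \<phi> 1 0}" using inP[of 1 1] by (simp add: near)
    have pp: "ppar (piS S (\<phi> 1 1)) (piS S (\<phi> 0 1)) \<or> ppar (piS S (\<phi> 1 1)) (piS S (\<phi> 1 0))"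
      by (rule cr_on_zero[OF line_basis_lift _ _ _ _ _ _ piS_pairwise_distinct(1,2)[OF Q Q Q Pd] _ _ c0])
         (use piS_mem Q in auto)
    have X: "\<And>t. t \<in> {\<phi> 0 1, \<phi> 0 0, \<phi> 1 0} \<Longrightarrow> Q2S S t" using Q by blast
    have i: "\<phi> 0 1 \<in> vec.span {\<phi> 0 1, \<phi> 0 0, \<phi> 1 0}" "\<phi> 1 0 \<in> vec.span {\<phi> 0 1, \<phi> 0 0, \<phi> 1 0}"
      by (simp_all add: vec.span_base)
    note inj = piS_inj_plane[OF Pd refl X Q Q in11]
    have "ppar (\<phi> 1 1) (\<phi> 0 1) \<or> ppar (\<phi> 1 1) (\<phi> 1 0)"
      using pp inj[OF _ i(1)] inj[OF _ i(2)] by (elim disjE) simp_all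
    \<comment> \<open>A vertex repeating \<open>\<phi> 0 1\<close> degenerates the face with far
      corner (1, 2); the spurious solution of x/0 = 0, repeating \<open>\<phi> 1 0\<close>,
      degenerates the one with far corner (2, 1).\<close>
    moreover have "irreducible_conic_plane (vec.span {\<phi> 1 1, \<phi> 0 1, \<phi> 0 2})"
      using irrP[of 1 2] by (simp add: near insert_commute)
    moreover have "irreducible_conic_plane (vec.span {\<phi> 1 1, \<phi> 1 0, \<phi> 2 0})"
      using irrP[of 2 1] by (simp add: near insert_commute)
    ultimately show False using ppar_reducible by blast
  qed
  have uniq: "ppar v v'"
    if kl: "k \<noteq> 0" "l \<noteq> 0" and v: "v \<in> ?L" "v \<noteq> 0" "v' \<in> ?L" "v' \<noteq> 0"
      and cr: "cr_on ?L (piS S (?Z \<phi> k l)) (piS S (?Y \<phi> k l)) (piS S (?X \<phi> k l)) v = lam"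
        "cr_on ?L (piS S (?Z \<phi> k l)) (piS S (?Y \<phi> k l)) (piS S (?X \<phi> k l)) v' = lam" for k l v v'
    by (rule cr_on_unique[OF line_basis_lift _ _ _ _ _ _ piS_pairwise_distinct[OF Q Q Q irrP[OF kl]]
          lam v(1,2) cr(1) v(3,4) cr(2)]) (use piS_mem Q in auto)
  have pi: "ppar (piS S (\<phi> k l)) (\<psi> k l)" for k l
  proof (induction k l rule: net_induct)
    case (axis1 k)
    have "ppar (piS S (real_pt (p k))) (p k)" using real_pt_Q2S(2) p by blast
    then show ?case unfolding ax1 using ppar_sym[OF psi_p] by (rule ppar_trans)
  next
    case (axis2 l)
    have "ppar (piS S (\<phi> 0 l)) (piS S (real_pt (\<psi> 0 l)))"
      using bd Q unfolding boundary_ok_def by (intro piS_ppar) auto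
    then show ?case using real_pt_Q2S(2)[OF psi(2,1)] by (rule ppar_trans)
  next
    case (far k l)
    obtain m n where fc: "far_corner m n = (k, l)" using far_corner_surj[OF far(1,2)] by blast
    \<comment> \<open>By induction the three known images agree with \<open>\<psi>\<close> up to
      scalars, so \<open>\<psi> k l\<close> solves the same equation as
      \<open>piS S (\<phi> k l)\<close>.\<close>
    have "cr_on ?L (piS S (?Z \<phi> k l)) (piS S (?Y \<phi> k l)) (piS S (?X \<phi> k l)) (\<psi> k l)
       = cr_on ?L (?Z \<psi> k l) (?Y \<psi> k l) (?X \<psi> k l) (\<psi> k l)"
      by (rule cr_on_ppar[OF line_basis_lift]) (use psi far ppar_refl[OF psi(1)] in auto)
    also have "\<dots> = lam" using face_cr_far_corner[OF fc, of \<psi>, OF psi(2)] psi_cr by simp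
    finally show ?case using piS_mem Q psi crW[OF far(1,2)] by (intro uniq[OF far(1,2)]) auto
  qed
  have un: "ppar (\<phi>' k l) (\<phi> k l)"
    if Q': "\<And>k n. Q2S S (\<phi>' k n)" and cn': "conic_net_Q4 \<phi>'" and bd': "boundary_ok p \<psi> \<phi>'"
      and fs': "\<And>m n. face_steiner \<phi>' m n = lam" for \<phi>' k l
  proof (induction k l rule: net_induct)
    case (axis1 k)
    then show ?case using bd' bd unfolding boundary_ok_def by (meson ppar_sym ppar_trans)
  next
    case (axis2 l)
    then show ?case using bd' bd unfolding boundary_ok_def by (meson ppar_sym ppar_trans)
  next
    case (far k l)
    obtain m n where fc: "far_corner m n = (k, l)" using far_corner_surj[OF far(1,2)] by blast
    have irr': "irreducible_conic_plane (face_plane \<phi>' m n)" using cn' by (simp add: conic_net_Q4_def)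
    \<comment> \<open>By induction the known vertices of both nets agree, hence so do their planes.
      The face plane of \<open>\<phi>'\<close> contains this plane and also has dimension 3, so
      \<open>\<phi>' k l\<close> lies on the same conic.\<close>
    have PP: "?P \<phi>' k l = ?P \<phi> k l" by (rule span_ppar[OF far(3-5)])
    have "?P \<phi>' k l \<subseteq> face_plane \<phi>' m n"
      unfolding face_plane_eq[OF fc] by (rule vec.span_mono) auto
    then have "?P \<phi>' k l = face_plane \<phi>' m n"
      using irr' irrP[OF far(1,2)] unfolding PP irreducible_conic_plane_def
      by (intro vec.subspace_dim_equal) auto
    moreover have "\<phi>' k l \<in> face_plane \<phi>' m n" unfolding face_plane_eq[OF fc] by (simp add: vec.span_base)
    ultimately have W': "\<phi>' k l \<in> ?P \<phi> k l" using PP by simp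
    have "cr_on ?L (piS S (?Z \<phi> k l)) (piS S (?Y \<phi> k l)) (piS S (?X \<phi> k l)) (piS S (\<phi>' k l))
       = cr_on ?L (piS S (?Z \<phi>' k l)) (piS S (?Y \<phi>' k l)) (piS S (?X \<phi>' k l)) (piS S (\<phi>' k l))"
      by (rule cr_on_ppar[OF line_basis_lift, symmetric])
         (use piS_mem Q Q' piS_ppar far(3-5) ppar_refl[OF piS_mem(2)[OF Q']] in auto)
    also have "\<dots> = lam"
      using face_steiner_eq_cr[OF Q' irr'] fs' face_cr_far_corner[OF fc, of "\<lambda>k l. piS S (\<phi>' k l)", OF piS_mem(1)[OF Q']] by simp
    finally have "ppar (piS S (\<phi>' k l)) (piS S (\<phi> k l))"
      using piS_mem Q Q' crW[OF far(1,2)] by (intro uniq[OF far(1,2)]) auto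
    then show ?case
      using piS_inj_plane[OF irrP[OF far(1,2)] refl _ Q' Q W' inP[OF far(1,2)]] Q by blast
  qed
  show ?thesis
    using Q cn bd fs un pi by (intro exI[of _ \<phi>] conjI allI impI) auto
qed

end

theorem mainTheorem1:
  fixes S :: "complex^4^4"
  assumes "H_linear S" and "S ** S = - mat 1"
  shows
    "(\<forall>\<phi>. conic_net_Q4 \<phi> \<and> (\<forall>m n. Q2S S (\<phi> m n)) \<longrightarrow>
        (\<forall>m n. face_cr (twistor_lift S) (\<lambda>k l. piS S (\<phi> k l)) m n = face_steiner \<phi> m n))
   \<and>
    (\<forall>(p :: int \<Rightarrow> c4) (lam :: complex) (\<psi> :: int \<Rightarrow> int \<Rightarrow> c4).
        (\<forall>k. p k \<noteq> 0 \<and> p k \<in> twistor_lift S) \<and>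
        (\<forall>k n. \<psi> k n \<noteq> 0 \<and> \<psi> k n \<in> twistor_lift S) \<and>
        (\<forall>k. ppar (\<psi> k 0) (p k)) \<and>
        (\<forall>k n. face_cr (twistor_lift S) \<psi> k n = lam) \<and>
        construction_irreducible S p \<psi> lam
      \<longrightarrow>
        (\<exists>\<phi>. (\<forall>k n. Q2S S (\<phi> k n)) \<and> conic_net_Q4 \<phi> \<and> boundary_ok p \<psi> \<phi> \<and>
              (\<forall>m n. face_steiner \<phi> m n = lam) \<and>
              (\<forall>\<phi>'. (\<forall>k n. Q2S S (\<phi>' k n)) \<and> conic_net_Q4 \<phi>' \<and> boundary_ok p \<psi> \<phi>' \<and>
                     (\<forall>m n. face_steiner \<phi>' m n = lam) \<longrightarrow> (\<forall>k n. ppar (\<phi>' k n) (\<phi> k n))) \<and>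
              (\<forall>k n. ppar (piS S (\<phi> k n)) (\<psi> k n))))"
proof -
  obtain a b c d where "twistor_pair S a b c d" using twistor_pair_exists[OF assms] by blast
  then interpret twistor_pair S a b c d .
  show ?thesis
  proof (intro conjI allI impI)
    fix \<phi> m n assume "conic_net_Q4 \<phi> \<and> (\<forall>m n. Q2S S (\<phi> m n))"
    then show "face_cr (twistor_lift S) (\<lambda>k l. piS S (\<phi> k l)) m n = face_steiner \<phi> m n"
      by (simp add: face_steiner_eq_cr conic_net_Q4_def)
  qed (rule cross_ratio_evolution; blast)
qed

end
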